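(* Let $K>1$. For each integer $s\ge1$ let $\alpha_s(K)=\frac{2Ks+1}{2K(s-1)+1}$, and let $S_K$ be the weighted forward shift on $\ell^2_+=\ell^2(\mathbb{N},\mathbb{C})$ given by $S_K(z_0,z_1,\dots)=(0,\alpha_1(K)z_0,\alpha_2(K)z_1,\dots)$. (1) If $T\in\mathcal{B}(\mathcal{H})$ ($\mathcal{H}$ a Hilbert space) satisfies $\|T^n\|\le K$ for every $n\ge0$, then $\|p(T)\|\le\|p(S_K)\|$ for every polynomial $p$ with complex coefficients. (2) For any fixed $K>1$, there is no power bounded weighted forward shift $E$ such that $\|f(A)\|\le\|f(E)\|$ holds for every power bounded operator $A$ on a Hilbert space with $\sup_{n\ge0}\|A^n\|\le K$ and every polynomial $f$.
   Context: An operator $A$ is power bounded if $\sup_{n\ge0}\|A^n\|<\infty$. A weighted forward shift is an operator of the form $(z_0,z_1,\dots)\mapsto(0,w_1z_0,w_2z_1,\dots)$ on $\ell^2_+$ for a bounded weight sequence $(w_s)$. *)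

theory Defs
  imports "HOL-Analysis.Analysis" "HOL-Computational_Algebra.Polynomial"
begin

class complex_vector = real_vector +
  fixes scaleC :: "complex \<Rightarrow> 'a \<Rightarrow> 'a"
  assumes scaleC_add_right: "scaleC a (x + y) = scaleC a x + scaleC a y"
    and scaleC_add_left: "scaleC (a + b) x = scaleC a x + scaleC b x"
    and scaleC_scaleC: "scaleC a (scaleC b x) = scaleC (a * b) x"
    and scaleC_one: "scaleC 1 x = x"
    and scaleR_scaleC: "scaleR r x = scaleC (complex_of_real r) x"

class complex_inner = complex_vector + real_normed_vector +
  fixes cinner :: "'a \<Rightarrow> 'a \<Rightarrow> complex"
  assumes cinner_commute: "cinner x y = cnj (cinner y x)"
    and cinner_add_left: "cinner (x + y) z = cinner x z + cinner y z"
    and cinner_scaleC_left: "cinner (scaleC c x) y = cnj c * cinner x y"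
    and cinner_ge_zero: "0 \<le> Re (cinner x x)"
    and cinner_eq_zero_iff: "cinner x x = 0 \<longleftrightarrow> x = 0"
    and norm_eq_sqrt_cinner: "norm x = sqrt (Re (cinner x x))"

class chilbert_space = complex_inner + complete_space

definition bounded_clinear :: "('a::complex_inner \<Rightarrow> 'a) \<Rightarrow> bool" where
  "bounded_clinear T \<longleftrightarrow> bounded_linear T \<and> (\<forall>c x. T (scaleC c x) = scaleC c (T x))"

definition cpoly_op :: "complex poly \<Rightarrow> ('a::complex_vector \<Rightarrow> 'a) \<Rightarrow> 'a \<Rightarrow> 'a" where
  "cpoly_op p T x = (\<Sum>i\<le>degree p. scaleC (coeff p i) ((T ^^ i) x))"

definition l2 :: "(nat \<Rightarrow> complex) set" where
  "l2 = {z. summable (\<lambda>n. (cmod (z n))\<^sup>2)}"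

definition l2norm :: "(nat \<Rightarrow> complex) \<Rightarrow> real" where
  "l2norm z = sqrt (\<Sum>n. (cmod (z n))\<^sup>2)"

text \<open>Operator norm of an operator on l2 (meaningful for bounded operators).\<close>
definition l2_opnorm :: "((nat \<Rightarrow> complex) \<Rightarrow> (nat \<Rightarrow> complex)) \<Rightarrow> real" where
  "l2_opnorm T = (SUP z\<in>{z\<in>l2. l2norm z \<le> 1}. l2norm (T z))"

definition l2_bounded_op :: "((nat \<Rightarrow> complex) \<Rightarrow> (nat \<Rightarrow> complex)) \<Rightarrow> bool" where
  "l2_bounded_op A \<longleftrightarrow>
     (\<forall>z\<in>l2. A z \<in> l2) \<and>
     (\<forall>z\<in>l2. \<forall>w\<in>l2. A (\<lambda>n. z n + w n) = (\<lambda>n. A z n + A w n)) \<and>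
     (\<forall>z\<in>l2. \<forall>c. A (\<lambda>n. c * z n) = (\<lambda>n. c * A z n)) \<and>
     (\<exists>C. \<forall>z\<in>l2. l2norm (A z) \<le> C * l2norm z)"

definition l2_poly_op :: "complex poly \<Rightarrow> ((nat \<Rightarrow> complex) \<Rightarrow> (nat \<Rightarrow> complex))
    \<Rightarrow> (nat \<Rightarrow> complex) \<Rightarrow> (nat \<Rightarrow> complex)" where
  "l2_poly_op p A z = (\<lambda>n. \<Sum>i\<le>degree p. coeff p i * (A ^^ i) z n)"

definition wshift :: "(nat \<Rightarrow> complex) \<Rightarrow> (nat \<Rightarrow> complex) \<Rightarrow> (nat \<Rightarrow> complex)" where
  "wshift w z = (\<lambda>n. if n = 0 then 0 else w n * z (n - 1))"

definition weighted_forward_shift :: "((nat \<Rightarrow> complex) \<Rightarrow> (nat \<Rightarrow> complex)) \<Rightarrow> bool" where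
  "weighted_forward_shift E \<longleftrightarrow> (\<exists>w. (\<exists>M. \<forall>s. cmod (w s) \<le> M) \<and> E = wshift w)"

definition l2_power_bounded :: "((nat \<Rightarrow> complex) \<Rightarrow> (nat \<Rightarrow> complex)) \<Rightarrow> bool" where
  "l2_power_bounded A \<longleftrightarrow> (\<exists>M. \<forall>n. l2_opnorm (A ^^ n) \<le> M)"

definition alphaK :: "real \<Rightarrow> nat \<Rightarrow> real" where
  "alphaK K s = (2 * K * real s + 1) / (2 * K * (real s - 1) + 1)"

definition S_K :: "real \<Rightarrow> (nat \<Rightarrow> complex) \<Rightarrow> (nat \<Rightarrow> complex)" where
  "S_K K = wshift (\<lambda>s. complex_of_real (alphaK K s))"

end

theory Submission
  imports Defs "HOL-Computational_Algebra.Formal_Power_Series"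
begin

text \<open>
  For (1), let \<open>b\<^sub>n = 1 / (2Kn + 1)\<^sup>2\<close> be the inverse squares of the weight products of \<open>S\<^sub>K\<close> and let
  \<open>\<gamma>\<close> be the coefficients of the reciprocal power series of \<open>\<Sum> b\<^sub>n z\<^sup>n\<close>. As \<open>b\<close> is logarithmically
  convex, Kaluza's lemma gives \<open>-b\<^sub>n \<le> \<gamma>\<^sub>n \<le> 0\<close> for \<open>n \<ge> 1\<close>, so \<open>K\<^sup>2 \<Sum> |\<gamma>\<^sub>n| \<le> 1\<close> over \<open>n \<ge> 1\<close>, and
  the form \<open>q(x) = \<Sum> \<gamma>\<^sub>m |T\<^sup>m x|\<^sup>2\<close> is nonnegative. Since \<open>\<Sum> b\<^sub>n q(T\<^sup>n x) = |x|\<^sup>2\<close>, the operator \<open>T\<close> is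
  modelled by a restriction of an amplification of the adjoint of \<open>S\<^sub>K\<close>. All series are truncated, so
  that neither a square root of \<open>q\<close> nor a tensor product is needed: a factorization of the Gram
  matrix of \<open>x, T x, T\<^sup>2 x, \<dots>\<close> reduces the amplification to the scalar case.

  For (2), a power bounded weighted shift is similar, through a diagonal operator, to a contractive
  one. The analytic Rudin--Shapiro type recursion
  \<open>f' = f + a z\<^sup>d g\<close>, \<open>g' = z\<^sup>d g - a f\<close> with \<open>a = 1 / \<surd>N\<close> produces, by the parallelogram law, polynomials
  that are bounded on all contractions independently of \<open>N\<close>, although their coefficients along a
  lacunary sequence add up to \<open>\<surd>N\<close>. Foguel's operator with a small coupling \<open>\<epsilon>\<close> has
  power bound \<open>1 + \<epsilon>\<close> and picks up exactly \<open>\<epsilon>\<close> times this sum.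
\<close>

section \<open>Bounded operators on l2\<close>

lemma sum_power2_cmod_le_suminf:
  assumes "z \<in> l2" "finite I"
  shows "(\<Sum>i\<in>I. (cmod (z i))\<^sup>2) \<le> (l2norm z)\<^sup>2"
proof -
  have s: "summable (\<lambda>n. (cmod (z n))\<^sup>2)" using assms by (simp add: l2_def)
  then have "(l2norm z)\<^sup>2 = (\<Sum>n. (cmod (z n))\<^sup>2)"
    unfolding l2norm_def by (simp add: suminf_nonneg)
  then show ?thesis using sum_le_suminf[OF s assms(2)] by simp
qed

lemma l2norm_nonneg: "z \<in> l2 \<Longrightarrow> 0 \<le> l2norm z"
  unfolding l2norm_def l2_def by (auto intro: suminf_nonneg)

lemma cmod_le_l2norm: "z \<in> l2 \<Longrightarrow> cmod (z i) \<le> l2norm z"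
  using sum_power2_cmod_le_suminf[of z "{i}"] l2norm_nonneg[of z]
  by (auto dest: power2_le_imp_le)

text \<open>Lets norm estimates be made on finite partial sums, with membership in \<open>l2\<close>
  as a by-product.\<close>

lemma l2_boundedI:
  assumes "\<And>n. (\<Sum>i<n. (cmod (z i))\<^sup>2) \<le> B\<^sup>2" "0 \<le> B"
  shows "z \<in> l2" "l2norm z \<le> B"
proof -
  show z: "z \<in> l2" unfolding l2_def mem_Collect_eq
    by (rule summableI_nonneg_bounded[of _ "B\<^sup>2"]) (use assms in auto)
  have "(\<Sum>n. (cmod (z n))\<^sup>2) \<le> B\<^sup>2"
    by (rule suminf_le_const) (use z assms in \<open>auto simp: l2_def\<close>)
  then show "l2norm z \<le> B" unfolding l2norm_def
    using assms(2) real_le_lsqrt by blast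
qed

lemma l2_add:
  assumes "z \<in> l2" "w \<in> l2"
  shows "(\<lambda>n. z n + w n) \<in> l2" "l2norm (\<lambda>n. z n + w n) \<le> l2norm z + l2norm w"
proof -
  have L2: "L2_set (\<lambda>i. cmod (x i)) {..<n} \<le> l2norm x" if "x \<in> l2" for x n
    unfolding L2_set_def using sum_power2_cmod_le_suminf[OF that, of "{..<n}"] l2norm_nonneg[OF that]
    by (intro real_le_lsqrt) auto
  have "(\<Sum>i<n. (cmod (z i + w i))\<^sup>2) \<le> (l2norm z + l2norm w)\<^sup>2" for n
  proof -
    have "L2_set (\<lambda>i. cmod (z i + w i)) {..<n} \<le> L2_set (\<lambda>i. cmod (z i) + cmod (w i)) {..<n}"
      by (rule L2_set_mono) (simp_all add: norm_triangle_ineq)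
    also have "\<dots> \<le> l2norm z + l2norm w"
      using L2_set_triangle_ineq[of "\<lambda>i. cmod (z i)" "\<lambda>i. cmod (w i)" "{..<n}"]
        L2[OF assms(1), of n] L2[OF assms(2), of n] by linarith
    finally show ?thesis unfolding L2_set_def by (rule sqrt_le_D)
  qed
  from l2_boundedI[OF this] show "(\<lambda>n. z n + w n) \<in> l2" "l2norm (\<lambda>n. z n + w n) \<le> l2norm z + l2norm w"
    using assms by (auto simp: l2norm_nonneg)
qed

lemma l2_scale:
  assumes "z \<in> l2"
  shows "(\<lambda>n. c * z n) \<in> l2" "l2norm (\<lambda>n. c * z n) = cmod c * l2norm z"
  using assms unfolding l2_def l2norm_def
  by (auto simp: norm_mult power_mult_distrib suminf_mult summable_mult real_sqrt_mult)

lemma l2_bounded_opE: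
  assumes "l2_bounded_op A"
  obtains C where "0 \<le> C" "\<And>z. z \<in> l2 \<Longrightarrow> l2norm (A z) \<le> C * l2norm z"
proof -
  obtain C where C: "\<forall>z\<in>l2. l2norm (A z) \<le> C * l2norm z"
    using assms by (auto simp: l2_bounded_op_def)
  have "l2norm (A z) \<le> max 0 C * l2norm z" if "z \<in> l2" for z
    using C that mult_right_mono[of C "max 0 C" "l2norm z"] l2norm_nonneg[OF that] by force
  then show thesis using that[of "max 0 C"] by auto
qed

lemma l2_bounded_op_mem: "l2_bounded_op A \<Longrightarrow> z \<in> l2 \<Longrightarrow> A z \<in> l2"
  by (auto simp: l2_bounded_op_def)

lemma l2_bounded_op_comp:
  assumes A: "l2_bounded_op A" and B: "l2_bounded_op B"
  shows "l2_bounded_op (A \<circ> B)"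
proof -
  obtain C where C: "0 \<le> C" "\<And>z. z \<in> l2 \<Longrightarrow> l2norm (A z) \<le> C * l2norm z"
    using l2_bounded_opE[OF A] by blast
  obtain D where D: "\<And>z. z \<in> l2 \<Longrightarrow> l2norm (B z) \<le> D * l2norm z"
    using l2_bounded_opE[OF B] by blast
  have "l2norm (A (B z)) \<le> (C * D) * l2norm z" if "z \<in> l2" for z
    using C(2)[OF l2_bounded_op_mem[OF B that]] mult_left_mono[OF D[OF that] C(1)] by simp
  then have "\<exists>C. \<forall>z\<in>l2. l2norm (A (B z)) \<le> C * l2norm z" by blast
  then show ?thesis using A B unfolding l2_bounded_op_def by simp
qed

lemma l2_bounded_op_funpow:
  assumes "l2_bounded_op A"
  shows "l2_bounded_op (A ^^ n)"
proof (induction n)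
  case 0
  show ?case by (auto simp: l2_bounded_op_def intro!: exI[of _ 1])
next
  case (Suc n)
  then show ?case using l2_bounded_op_comp[OF assms, of "A ^^ n"] by (simp only: funpow.simps)
qed

lemma l2_bounded_op_add:
  assumes A: "l2_bounded_op A" and B: "l2_bounded_op B"
  shows "l2_bounded_op (\<lambda>z n. A z n + B z n)"
proof -
  obtain C where C: "\<And>z. z \<in> l2 \<Longrightarrow> l2norm (A z) \<le> C * l2norm z"
    using l2_bounded_opE[OF A] by blast
  obtain D where D: "\<And>z. z \<in> l2 \<Longrightarrow> l2norm (B z) \<le> D * l2norm z"
    using l2_bounded_opE[OF B] by blast
  have "l2norm (\<lambda>n. A z n + B z n) \<le> (C + D) * l2norm z" if "z \<in> l2" for z
    using l2_add(2)[OF l2_bounded_op_mem[OF A that] l2_bounded_op_mem[OF B that]]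
      C[OF that] D[OF that] by (simp add: distrib_right)
  then have "\<exists>C. \<forall>z\<in>l2. l2norm (\<lambda>n. A z n + B z n) \<le> C * l2norm z" by blast
  moreover have "\<forall>z\<in>l2. (\<lambda>n. A z n + B z n) \<in> l2"
    using l2_add(1) l2_bounded_op_mem[OF A] l2_bounded_op_mem[OF B] by blast
  ultimately show ?thesis using A B
    unfolding l2_bounded_op_def by (simp add: fun_eq_iff algebra_simps)
qed

lemma l2_bounded_op_scale:
  assumes A: "l2_bounded_op A"
  shows "l2_bounded_op (\<lambda>z n. c * A z n)"
proof -
  obtain C where "\<And>z. z \<in> l2 \<Longrightarrow> l2norm (A z) \<le> C * l2norm z"
    using l2_bounded_opE[OF A] by blast
  then have "\<forall>z\<in>l2. l2norm (\<lambda>n. c * A z n) \<le> (cmod c * C) * l2norm z"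
    using l2_scale(2)[OF l2_bounded_op_mem[OF A], of _ c] by (simp add: mult.assoc mult_left_mono)
  then have "\<exists>C. \<forall>z\<in>l2. l2norm (\<lambda>n. c * A z n) \<le> C * l2norm z" by blast
  moreover have "\<forall>z\<in>l2. (\<lambda>n. c * A z n) \<in> l2"
    using l2_scale(1) l2_bounded_op_mem[OF A] by blast
  ultimately show ?thesis using A
    unfolding l2_bounded_op_def by (simp add: fun_eq_iff algebra_simps)
qed

lemma l2_bounded_op_poly:
  assumes A: "l2_bounded_op A"
  shows "l2_bounded_op (l2_poly_op p A)"
proof -
  have "l2_bounded_op (\<lambda>z n. \<Sum>i\<le>d. coeff p i * (A ^^ i) z n)" for d
  proof (induction d)
    case 0
    then show ?case using l2_bounded_op_scale[OF l2_bounded_op_funpow[OF A, of 0]] by simp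
  next
    case (Suc d)
    show ?case
      using l2_bounded_op_add[OF Suc l2_bounded_op_scale[OF l2_bounded_op_funpow[OF A, of "Suc d"]]]
      by simp
  qed
  moreover have "l2_poly_op p A = (\<lambda>z n. \<Sum>i\<le>degree p. coeff p i * (A ^^ i) z n)"
    by (intro ext) (simp add: l2_poly_op_def)
  ultimately show ?thesis by simp
qed

lemma l2_zero: "(\<lambda>n. 0) \<in> l2" "l2norm (\<lambda>n. 0) = 0"
  by (auto simp: l2_def l2norm_def)

lemma l2_opnorm_le:
  assumes "\<And>z. z \<in> l2 \<Longrightarrow> l2norm z \<le> 1 \<Longrightarrow> l2norm (A z) \<le> C"
  shows "l2_opnorm A \<le> C"
  unfolding l2_opnorm_def
proof (rule cSUP_least)
  show "{z \<in> l2. l2norm z \<le> 1} \<noteq> {}" using l2_zero by force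
qed (use assms in auto)

text \<open>The supremum in \<open>l2_opnorm\<close> carries information only if its range is
  bounded above; this is where boundedness of \<open>A\<close> enters. The rest is rescaling
  \<open>z\<close> to norm 1, so norm 0 is treated apart.\<close>

lemma l2norm_le_opnorm:
  assumes A: "l2_bounded_op A" and z: "z \<in> l2"
  shows "l2norm (A z) \<le> l2_opnorm A * l2norm z"
proof (cases "l2norm z = 0")
  case True
  obtain C where "\<And>z. z \<in> l2 \<Longrightarrow> l2norm (A z) \<le> C * l2norm z"
    using l2_bounded_opE[OF A] by blast
  from this[OF z] show ?thesis using True by simp
next
  case False
  define r where "r = l2norm z"
  have r: "r > 0" using False l2norm_nonneg[OF z] by (simp add: r_def)
  obtain C where C: "0 \<le> C" "\<And>z. z \<in> l2 \<Longrightarrow> l2norm (A z) \<le> C * l2norm z"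
    using l2_bounded_opE[OF A] by blast
  have bdd: "bdd_above ((\<lambda>z. l2norm (A z)) ` {z\<in>l2. l2norm z \<le> 1})"
  proof (rule bdd_aboveI2)
    fix x assume "x \<in> {z\<in>l2. l2norm z \<le> 1}"
    then show "l2norm (A x) \<le> C" using C(2)[of x] C(1) mult_left_le by force
  qed
  define u where "u = (\<lambda>n. complex_of_real (1/r) * z n)"
  have u: "u \<in> l2" "l2norm u \<le> 1"
    unfolding u_def using l2_scale[OF z, of "complex_of_real (1/r)"] r
    by (simp_all add: r_def norm_divide)
  have "A u = (\<lambda>n. complex_of_real (1/r) * A z n)"
    using A z unfolding u_def l2_bounded_op_def by blast
  then have "l2norm (A u) = (1/r) * l2norm (A z)"
    using l2_scale(2)[OF l2_bounded_op_mem[OF A z], of "complex_of_real (1/r)"] r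
    by (simp add: norm_divide)
  moreover have "l2norm (A u) \<le> l2_opnorm A"
    unfolding l2_opnorm_def by (rule cSUP_upper[OF _ bdd]) (use u in auto)
  ultimately show ?thesis using r by (simp add: r_def field_simps)
qed

lemma l2_unit_vector:
  defines "e i \<equiv> (\<lambda>n. if n = i then 1 else 0)"
  shows "e i \<in> l2" "l2norm (e i) = 1"
proof -
  have "(\<Sum>j<n. (cmod (e i j))\<^sup>2) \<le> 1\<^sup>2" for n
    unfolding e_def by (simp add: if_distrib[of cmod] if_distrib[of "\<lambda>x. x\<^sup>2"] cong: if_cong)
  note e = l2_boundedI[OF this]
  show "e i \<in> l2" using e(1) by simp
  have "1 \<le> l2norm (e i)" using cmod_le_l2norm[OF e(1), of i] by (simp add: e_def)
  then show "l2norm (e i) = 1" using e(2) by simp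
qed

lemma l2_opnorm_nonneg:
  assumes "l2_bounded_op A"
  shows "0 \<le> l2_opnorm A"
  using l2norm_le_opnorm[OF assms l2_unit_vector(1)[of 0]]
    l2norm_nonneg[OF l2_bounded_op_mem[OF assms l2_unit_vector(1)[of 0]]]
  by (simp add: l2_unit_vector(2))

section \<open>Weighted shifts on \<open>l2\<close> and their powers\<close>

lemma l2norm_wshift_le:
  assumes M: "\<And>s. cmod (w s) \<le> M" and z: "z \<in> l2"
  shows "wshift w z \<in> l2" "l2norm (wshift w z) \<le> M * l2norm z"
proof -
  have M0: "0 \<le> M" using M[of 0] norm_ge_zero order_trans by blast
  have "(\<Sum>i<n. (cmod (wshift w z i))\<^sup>2) \<le> (M * l2norm z)\<^sup>2" for n
  proof (cases n)
    case 0
    then show ?thesis by simp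
  next
    case (Suc m)
    have "(\<Sum>i<n. (cmod (wshift w z i))\<^sup>2) = (\<Sum>i<m. (cmod (w (Suc i)))\<^sup>2 * (cmod (z i))\<^sup>2)"
      unfolding Suc sum.lessThan_Suc_shift by (simp add: wshift_def norm_mult power_mult_distrib)
    also have "\<dots> \<le> (\<Sum>i<m. M\<^sup>2 * (cmod (z i))\<^sup>2)"
      by (intro sum_mono mult_right_mono power_mono M) auto
    also have "\<dots> \<le> M\<^sup>2 * (l2norm z)\<^sup>2"
      unfolding sum_distrib_left[symmetric]
      by (intro mult_left_mono sum_power2_cmod_le_suminf z) auto
    finally show ?thesis by (simp add: power_mult_distrib)
  qed
  from l2_boundedI[OF this] M0 l2norm_nonneg[OF z]
  show "wshift w z \<in> l2" "l2norm (wshift w z) \<le> M * l2norm z" by simp_all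
qed

lemma l2_bounded_op_wshift:
  assumes "\<And>s. cmod (w s) \<le> M"
  shows "l2_bounded_op (wshift w)"
proof -
  have "\<forall>z\<in>l2. wshift w z \<in> l2" "\<exists>C. \<forall>z\<in>l2. l2norm (wshift w z) \<le> C * l2norm z"
    using l2norm_wshift_le[of w M, OF assms] by auto
  then show ?thesis
    unfolding l2_bounded_op_def by (simp add: wshift_def fun_eq_iff algebra_simps)
qed

text \<open>The product collects the weights met on the way from coordinate \<open>i - n\<close> to
  \<open>i\<close>; for \<open>n = 0\<close> its range is empty.\<close>

lemma wshift_funpow:
  "(wshift w ^^ n) z i = (if i < n then 0 else (\<Prod>k=i-n+1..i. w k) * z (i - n))"
proof (induction n arbitrary: i)
  case (Suc n)
  show ?case
  proof (cases i)
    case 0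
    then show ?thesis by (simp add: wshift_def)
  next
    case (Suc j)
    then show ?thesis using Suc.IH[of j]
      by (auto simp: wshift_def prod.nat_ivl_Suc' mult.assoc)
  qed
qed auto

text \<open>Allows polynomials of different degrees to be evaluated over a common index
  range.\<close>

lemma l2_poly_op_eq:
  assumes "degree p \<le> d"
  shows "l2_poly_op p A z n = (\<Sum>i\<le>d. coeff p i * (A ^^ i) z n)"
  unfolding l2_poly_op_def using assms
  by (intro sum.mono_neutral_left) (auto simp: coeff_eq_0)

section \<open>Power bounded operators and the shift with weights alphaK\<close>

text \<open>Splits off the last index. Hermitian symmetry makes the last column the conjugate of the
  last row, so a single linear functional describes both cross terms.\<close>

lemma psd_form_Suc:
  fixes G :: "nat \<Rightarrow> nat \<Rightarrow> complex"
  assumes herm: "\<And>r s. r < Suc P \<Longrightarrow> s < Suc P \<Longrightarrow> G r s = cnj (G s r)"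
  shows "(\<Sum>r<Suc P. \<Sum>s<Suc P. cnj (a r) * a s * G r s)
    = (\<Sum>r<P. \<Sum>s<P. cnj (a r) * a s * G r s) + cnj (a P) * (\<Sum>s<P. G P s * a s)
      + a P * cnj (\<Sum>s<P. G P s * a s) + cnj (a P) * a P * G P P"
proof -
  have "(\<Sum>r<P. cnj (a r) * a P * G r P) = a P * cnj (\<Sum>s<P. G P s * a s)"
    unfolding cnj_sum sum_distrib_left
  proof (rule sum.cong)
    fix r assume "r \<in> {..<P}"
    then have "G r P = cnj (G P r)" by (intro herm) auto
    then show "cnj (a r) * a P * G r P = a P * cnj (G P r * a r)" by simp
  qed simp
  moreover have "(\<Sum>s<P. cnj (a P) * a s * G P s) = cnj (a P) * (\<Sum>s<P. G P s * a s)"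
    by (simp add: sum_distrib_left mult_ac)
  ultimately show ?thesis by (simp add: sum.distrib algebra_simps)
qed

text \<open>Cholesky factorization by induction on the size: the last row, divided by the root of
  its diagonal entry, gives one factor; the Schur complement is again positive semidefinite and
  gives the others.\<close>

lemma psd_gram_factorization:
  fixes G :: "nat \<Rightarrow> nat \<Rightarrow> complex"
  assumes "\<And>r s. r < P \<Longrightarrow> s < P \<Longrightarrow> G r s = cnj (G s r)"
    and "\<And>a. 0 \<le> Re (\<Sum>r<P. \<Sum>s<P. cnj (a r) * a s * G r s)"
  shows "\<exists>X. \<forall>r<P. \<forall>s<P. G r s = (\<Sum>k<P. cnj (X k r) * X k s)"
  using assms
proof (induction P arbitrary: G)
  case 0
  then show ?case by simp
next
  case (Suc P)
  note herm = Suc.prems(1) and psd = Suc.prems(2)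
  define g where "g = Re (G P P)"
  have gP: "G P P = complex_of_real g"
    using herm[of P P] by (simp add: g_def complex_eq_iff)
  define L where "L a = (\<Sum>s<P. G P s * a s)" for a :: "nat \<Rightarrow> complex"
  \<comment> \<open>The last coordinate \<open>c\<close> is kept free: a large value handles a
    vanishing pivot, the minimizing one the Schur complement.\<close>
  have form: "0 \<le> Re ((\<Sum>r<P. \<Sum>s<P. cnj (a r) * a s * G r s) + cnj c * L a + c * cnj (L a)
      + cnj c * c * complex_of_real g)" for a c
  proof -
    have eq: "(\<Sum>r<P. \<Sum>s<P. cnj ((a(P := c)) r) * (a(P := c)) s * G r s) = (\<Sum>r<P. \<Sum>s<P. cnj (a r) * a s * G r s)"
      by (intro sum.cong) auto
    have eqL: "(\<Sum>s<P. G P s * (a(P := c)) s) = L a"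
      unfolding L_def by (intro sum.cong) auto
    have "(\<Sum>r<Suc P. \<Sum>s<Suc P. cnj ((a(P := c)) r) * (a(P := c)) s * G r s)
      = (\<Sum>r<P. \<Sum>s<P. cnj (a r) * a s * G r s) + cnj c * L a + c * cnj (L a)
        + cnj c * c * complex_of_real g"
      unfolding eq[symmetric] eqL[symmetric] gP[symmetric]
      by (subst psd_form_Suc[of P G "a(P := c)"], rule herm) (simp_all only: fun_upd_same)
    then show ?thesis using psd[of "a(P := c)"] by (simp only:)
  qed
  have g0: "0 \<le> g" using form[of "\<lambda>_. 0" 1] by (simp add: L_def)
  \<comment> \<open>A zero pivot kills its row: otherwise the form at \<open>\<delta>\<close>, with
    last coordinate a multiple of \<open>- G P s\<close>, is affine in that multiple with negative
    slope. The final choice of the multiple makes the value \<open>- 1\<close>.\<close>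
  have deg: "G P s = 0" if "g = 0" "s < P" for s
  proof (rule ccontr)
    assume nz: "G P s \<noteq> 0"
    define \<delta> where "\<delta> = (\<lambda>i. if i = s then 1 else (0::complex))"
    have L: "L \<delta> = G P s" using \<open>s < P\<close> by (simp add: L_def \<delta>_def if_distrib cong: if_cong)
    have F: "(\<Sum>r<P. \<Sum>s<P. cnj (\<delta> r) * \<delta> s * G r s) = G s s"
      using \<open>s < P\<close> by (simp add: \<delta>_def if_distrib[of cnj] if_distrib[of "\<lambda>x. x * _"]
          if_distrib[of "\<lambda>x. _ * x"] cong: if_cong)
    have ineq: "0 \<le> Re (G s s) - 2 * c * (cmod (G P s))\<^sup>2" for c
    proof -
      show ?thesis
        using form[of \<delta> "- (complex_of_real c * G P s)"]
        unfolding L F \<open>g = 0\<close> cmod_power2 by (simp add: power2_eq_square algebra_simps)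
    qed
    have "(cmod (G P s))\<^sup>2 > 0" using nz by simp
    then show False
      using ineq[of "(Re (G s s) + 1) / (2 * (cmod (G P s))\<^sup>2)"] by (simp add: field_simps)
  qed
  \<comment> \<open>Schur complement; for \<open>g = 0\<close> the division gives \<open>0\<close>, which is right because then row \<open>P\<close> vanishes.\<close>
  define G' where "G' r s = G r s - cnj (G P r) * G P s / complex_of_real g" for r s
  have herm': "G' r s = cnj (G' s r)" if "r < P" "s < P" for r s
    using herm[of r s] that by (simp add: G'_def mult.commute)
  have psd': "0 \<le> Re (\<Sum>r<P. \<Sum>s<P. cnj (a r) * a s * G' r s)" for a
  proof -
    have "(\<Sum>r<P. \<Sum>s<P. cnj (a r) * a s * G' r s)
      = (\<Sum>r<P. \<Sum>s<P. cnj (a r) * a s * G r s)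
        - (\<Sum>r<P. \<Sum>s<P. cnj (a r) * a s * (cnj (G P r) * G P s / complex_of_real g))"
      by (simp add: G'_def right_diff_distrib sum_subtractf)
    also have "(\<Sum>r<P. \<Sum>s<P. cnj (a r) * a s * (cnj (G P r) * G P s / complex_of_real g))
      = cnj (L a) * L a / complex_of_real g"
      unfolding L_def cnj_sum sum_product sum_divide_distrib
      by (intro sum.cong refl) (simp add: mult_ac)
    finally have eq: "(\<Sum>r<P. \<Sum>s<P. cnj (a r) * a s * G' r s)
      = (\<Sum>r<P. \<Sum>s<P. cnj (a r) * a s * G r s) - cnj (L a) * L a / complex_of_real g" .
    \<comment> \<open>For \<open>g > 0\<close> this last coordinate minimizes the form, and the
      minimum is the form of the Schur complement.\<close>
    show ?thesis
      unfolding eq using form[of a "- (L a / complex_of_real g)"]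
      by (cases "g = 0") (simp_all add: mult_ac)
  qed
  obtain X where X: "\<And>r s. r < P \<Longrightarrow> s < P \<Longrightarrow> G' r s = (\<Sum>k<P. cnj (X k r) * X k s)"
    using Suc.IH[of G'] herm' psd' by blast
  \<comment> \<open>Triangular shape: the old components vanish on the last index, so only component
    \<open>P\<close> contributes to row and column \<open>P\<close>.\<close>
  define Y where "Y k r = (if k < P then (if r < P then X k r else 0) else G P r / complex_of_real (sqrt g))" for k r
  have rt: "complex_of_real (sqrt g) * complex_of_real (sqrt g) = complex_of_real g"
    using g0 by (simp flip: of_real_mult)
  have YP: "cnj (Y P r) * Y P s = cnj (G P r) * G P s / complex_of_real g" for r s
    by (simp add: Y_def rt)
  have Pr: "cnj (Y P P) * Y P s = G P s" if "s < Suc P" for s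
    unfolding YP using deg[of s] that by (cases "g = 0") (auto simp: gP less_Suc_eq)
  have "G r s = (\<Sum>k<Suc P. cnj (Y k r) * Y k s)" if rs: "r < Suc P" "s < Suc P" for r s
  proof -
    consider "r < P" "s < P" | "r = P" | "s = P" using rs by linarith
    then show ?thesis
    proof cases
      case 1
      then have "(\<Sum>k<P. cnj (Y k r) * Y k s) = G' r s"
        unfolding X[OF 1] by (intro sum.cong) (auto simp: Y_def)
      then show ?thesis by (simp add: YP G'_def)
    next
      case 2
      then have "(\<Sum>k<P. cnj (Y k r) * Y k s) = 0"
        by (intro sum.neutral) (auto simp: Y_def)
      then show ?thesis using 2 Pr[OF rs(2)] by simp
    next
      case 3
      then have "(\<Sum>k<P. cnj (Y k r) * Y k s) = 0"
        by (intro sum.neutral) (auto simp: Y_def)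
      moreover have "cnj (Y P r) * Y P P = G r P"
        using arg_cong[OF Pr[OF rs(1)], of cnj] herm[OF _ rs(1), of P]
        by (metis complex_cnj_cnj complex_cnj_mult lessI mult.commute)
      ultimately show ?thesis using 3 by simp
    qed
  qed
  then show ?case by blast
qed

text \<open>Each component \<open>X k\<close> of the Gram factorization is a scalar sequence to
  which \<open>scal\<close> applies; summing over \<open>k\<close> gives the vector inequality with
  the same constant \<open>C\<close>. The condition on \<open>P\<close> keeps all indices
  \<open>n + i\<close> inside the factorized block.\<close>

lemma psd_amplification:
  fixes G :: "nat \<Rightarrow> nat \<Rightarrow> complex" and b :: "nat \<Rightarrow> real"
  assumes herm: "\<And>r s. G r s = cnj (G s r)"
    and psd: "\<And>a. 0 \<le> Re (\<Sum>r<P. \<Sum>s<P. cnj (a r) * a s * G r s)"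
    and scal: "\<And>x. (\<Sum>n\<le>N. b n * (cmod (\<Sum>i\<le>d. p i * x (n + i)))\<^sup>2) \<le> C * (\<Sum>n<P. b n * (cmod (x n))\<^sup>2)"
    and P: "N + d < P"
  shows "(\<Sum>n\<le>N. b n * Re (\<Sum>i\<le>d. \<Sum>j\<le>d. cnj (p i) * p j * G (n + i) (n + j)))
    \<le> C * (\<Sum>n<P. b n * Re (G n n))"
proof -
  obtain X where X: "\<And>r s. r < P \<Longrightarrow> s < P \<Longrightarrow> G r s = (\<Sum>k<P. cnj (X k r) * X k s)"
    using psd_gram_factorization[of P G, OF herm psd] by blast
  have sq: "Re (cnj z * z) = (cmod z)\<^sup>2" for z
    unfolding cmod_power2 by (simp add: power2_eq_square)
  have l: "Re (\<Sum>i\<le>d. \<Sum>j\<le>d. cnj (p i) * p j * G (n + i) (n + j)) = (\<Sum>k<P. (cmod (\<Sum>i\<le>d. p i * X k (n + i)))\<^sup>2)"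
    if "n \<le> N" for n
  proof -
    have "(\<Sum>i\<le>d. \<Sum>j\<le>d. cnj (p i) * p j * G (n + i) (n + j))
      = (\<Sum>i\<le>d. \<Sum>j\<le>d. \<Sum>k<P. cnj (p i * X k (n + i)) * (p j * X k (n + j)))"
    proof (intro sum.cong refl)
      fix i j assume "i \<in> {..d}" "j \<in> {..d}"
      then have "n + i < P" "n + j < P" using P that by auto
      then show "cnj (p i) * p j * G (n + i) (n + j) = (\<Sum>k<P. cnj (p i * X k (n + i)) * (p j * X k (n + j)))"
        by (simp add: X sum_distrib_left mult_ac)
    qed
    also have "\<dots> = (\<Sum>i\<le>d. \<Sum>k<P. \<Sum>j\<le>d. cnj (p i * X k (n + i)) * (p j * X k (n + j)))"
      by (intro sum.cong refl sum.swap)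
    also have "\<dots> = (\<Sum>k<P. \<Sum>i\<le>d. \<Sum>j\<le>d. cnj (p i * X k (n + i)) * (p j * X k (n + j)))"
      by (rule sum.swap)
    also have "\<dots> = (\<Sum>k<P. cnj (\<Sum>i\<le>d. p i * X k (n + i)) * (\<Sum>i\<le>d. p i * X k (n + i)))"
      unfolding cnj_sum sum_product ..
    finally show ?thesis by (simp only: Re_sum sq)
  qed
  have r: "Re (G n n) = (\<Sum>k<P. (cmod (X k n))\<^sup>2)" if "n < P" for n
    by (simp only: X[OF that that] Re_sum sq)
  have "(\<Sum>n\<le>N. b n * Re (\<Sum>i\<le>d. \<Sum>j\<le>d. cnj (p i) * p j * G (n + i) (n + j)))
      = (\<Sum>n\<le>N. \<Sum>k<P. b n * (cmod (\<Sum>i\<le>d. p i * X k (n + i)))\<^sup>2)"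
    by (intro sum.cong refl) (simp only: l sum_distrib_left atMost_iff)
  also have "\<dots> = (\<Sum>k<P. \<Sum>n\<le>N. b n * (cmod (\<Sum>i\<le>d. p i * X k (n + i)))\<^sup>2)"
    by (rule sum.swap)
  also have "\<dots> \<le> (\<Sum>k<P. C * (\<Sum>n<P. b n * (cmod (X k n))\<^sup>2))"
    by (intro sum_mono scal)
  also have "\<dots> = C * (\<Sum>k<P. \<Sum>n<P. b n * (cmod (X k n))\<^sup>2)"
    by (simp add: sum_distrib_left)
  also have "(\<Sum>k<P. \<Sum>n<P. b n * (cmod (X k n))\<^sup>2) = (\<Sum>n<P. \<Sum>k<P. b n * (cmod (X k n))\<^sup>2)"
    by (rule sum.swap)
  also have "\<dots> = (\<Sum>n<P. b n * Re (G n n))"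
    by (intro sum.cong refl) (simp add: r sum_distrib_left)
  finally show ?thesis .
qed

text \<open>
  The left-hand side is \<open>|p(S)\<^sup>*y|\<^sup>2\<close>, cut off after \<open>N\<close>, for \<open>S\<close> the shift and \<open>y\<^sub>n = x\<^sub>n / \<beta>\<^sub>n\<close>, up to complex
  conjugation of \<open>p\<close>.
\<close>

lemma wshift_adjoint_bound:
  fixes \<beta> :: "nat \<Rightarrow> real"
  assumes op: "l2_bounded_op (wshift w)" and \<beta>: "\<And>n. 0 < \<beta> n"
    and w: "\<And>n. w (Suc n) = complex_of_real (\<beta> (Suc n) / \<beta> n)"
  shows "(\<Sum>n\<le>N. (1 / (\<beta> n)\<^sup>2) * (cmod (\<Sum>i\<le>degree p. coeff p i * x (n + i)))\<^sup>2)
    \<le> (l2_opnorm (l2_poly_op p (wshift w)))\<^sup>2 * (\<Sum>n<Suc (N + degree p). (1 / (\<beta> n)\<^sup>2) * (cmod (x n))\<^sup>2)"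
    (is "_ \<le> ?M\<^sup>2 * _")
proof -
  \<comment> \<open>Duality test vector: \<open>u\<close> is the conjugate of the transpose of
    \<open>p(S)\<close> applied to \<open>y\<close>, cut off after \<open>N\<close>. Hence the
    bilinear pairing of \<open>p(S) u\<close> with \<open>y\<close> equals \<open>W\<close>, the
    squared norm of \<open>u\<close>.\<close>
  define u where "u n = (if n \<le> N then cnj (\<Sum>i\<le>degree p. coeff p i * x (n + i)) / complex_of_real (\<beta> n) else 0)" for n
  define y where "y n = x n / complex_of_real (\<beta> n)" for n
  define W where "W = (\<Sum>n\<le>N. (cmod (u n))\<^sup>2)"
  let ?P = "Suc (N + degree p)"
  have u_sum: "(\<Sum>n<m. (cmod (u n))\<^sup>2) \<le> (sqrt W)\<^sup>2" for m
  proof -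
    have "(\<Sum>n<m. (cmod (u n))\<^sup>2) = (\<Sum>n\<in>{..<m} \<inter> {..N}. (cmod (u n))\<^sup>2)"
      by (rule sum.mono_neutral_right) (auto simp: u_def)
    also have "\<dots> \<le> W" unfolding W_def by (rule sum_mono2) auto
    finally show ?thesis by (simp add: W_def sum_nonneg)
  qed
  have W0: "0 \<le> W" by (simp add: W_def sum_nonneg)
  have u: "u \<in> l2" "l2norm u \<le> sqrt W"
    using l2_boundedI[OF u_sum] W0 by auto
  \<comment> \<open>The quotients \<open>\<beta> (Suc n) / \<beta> n\<close> telescope.\<close>
  have prods: "(\<Prod>k=m-i+1..m. w k) = complex_of_real (\<beta> m / \<beta> (m - i))" if "i \<le> m" for m i
    using that
  proof (induction i)
    case 0
    then show ?case using \<beta>[of m] by simp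
  next
    case (Suc i)
    then have "m - Suc i + 1 = m - i" "w (m - i) = complex_of_real (\<beta> (m - i) / \<beta> (m - Suc i))"
      using w[of "m - Suc i"] by (simp_all add: Suc_diff_Suc)
    moreover have "(\<Prod>k=m-i..m. w k) = w (m - i) * (\<Prod>k=m-i+1..m. w k)"
      by (subst prod.atLeast_Suc_atMost) auto
    ultimately show ?case using Suc \<beta>[of "m - i"] by (simp add: field_simps)
  qed
  define h where "h i n = coeff p i * (u n / complex_of_real (\<beta> n)) * x (n + i)" for i n
  have expand: "l2_poly_op p (wshift w) u m * y m = (\<Sum>i\<le>degree p. if i \<le> m then h i (m - i) else 0)" for m
    unfolding l2_poly_op_def sum_distrib_right
  proof (intro sum.cong refl)
    fix i
    show "coeff p i * (wshift w ^^ i) u m * y m = (if i \<le> m then h i (m - i) else 0)"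
      using \<beta>[of m] prods[of i m] by (simp add: wshift_funpow h_def y_def)
  qed
  have "(\<Sum>m<?P. l2_poly_op p (wshift w) u m * y m)
      = (\<Sum>i\<le>degree p. \<Sum>m<?P. if i \<le> m then h i (m - i) else 0)"
    unfolding expand by (rule sum.swap)
  also have "\<dots> = (\<Sum>i\<le>degree p. \<Sum>n\<le>N. h i n)"
  proof (rule sum.cong)
    fix i assume i: "i \<in> {..degree p}"
    \<comment> \<open>Substituting \<open>m = n + i\<close>: indices with \<open>n > N\<close> drop
      out because \<open>u\<close> vanishes there, and \<open>?P\<close> is large enough to contain
      \<open>N + i\<close>.\<close>
    have "(\<Sum>m<?P. if i \<le> m then h i (m - i) else 0) = (\<Sum>m\<in>{0+i..N+i}. h i (m - i))"
      by (rule sum.mono_neutral_cong_right) (use i in \<open>auto simp: h_def u_def\<close>)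
    also have "\<dots> = (\<Sum>n\<le>N. h i n)"
      unfolding sum.shift_bounds_cl_nat_ivl by (simp add: atMost_atLeast0)
    finally show "(\<Sum>m<?P. if i \<le> m then h i (m - i) else 0) = (\<Sum>n\<le>N. h i n)" .
  qed simp
  also have "\<dots> = (\<Sum>n\<le>N. \<Sum>i\<le>degree p. h i n)" by (rule sum.swap)
  also have "\<dots> = (\<Sum>n\<le>N. complex_of_real ((cmod (u n))\<^sup>2))"
  proof (intro sum.cong refl)
    fix n assume "n \<in> {..N}"
    then have "cnj (u n) = (\<Sum>i\<le>degree p. coeff p i * x (n + i)) / complex_of_real (\<beta> n)"
      by (simp add: u_def del: cnj_sum)
    moreover have "(\<Sum>i\<le>degree p. h i n) = u n / complex_of_real (\<beta> n) * (\<Sum>i\<le>degree p. coeff p i * x (n + i))"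
      unfolding h_def sum_distrib_left by (intro sum.cong refl) (simp add: mult_ac)
    ultimately have "(\<Sum>i\<le>degree p. h i n) = u n * cnj (u n)" by simp
    then show "(\<Sum>i\<le>degree p. h i n) = complex_of_real ((cmod (u n))\<^sup>2)"
      by (simp only: complex_norm_square)
  qed
  finally have pairing: "(\<Sum>m<?P. l2_poly_op p (wshift w) u m * y m) = complex_of_real W"
    by (simp add: W_def)
  have pu: "l2_poly_op p (wshift w) u \<in> l2"
    by (rule l2_bounded_op_mem[OF l2_bounded_op_poly[OF op] u(1)])
  have M0: "0 \<le> ?M" by (rule l2_opnorm_nonneg[OF l2_bounded_op_poly[OF op]])
  have "W = cmod (\<Sum>m<?P. l2_poly_op p (wshift w) u m * y m)"
    unfolding pairing using W0 by simp
  also have "\<dots> \<le> (\<Sum>m<?P. \<bar>cmod (l2_poly_op p (wshift w) u m)\<bar> * \<bar>cmod (y m)\<bar>)"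
    by (rule order_trans[OF norm_sum]) (simp add: norm_mult)
  also have "\<dots> \<le> L2_set (\<lambda>m. cmod (l2_poly_op p (wshift w) u m)) {..<?P} * L2_set (\<lambda>m. cmod (y m)) {..<?P}"
    by (rule L2_set_mult_ineq)
  also have "\<dots> \<le> (?M * sqrt W) * L2_set (\<lambda>m. cmod (y m)) {..<?P}"
  proof (rule mult_right_mono)
    have "L2_set (\<lambda>m. cmod (l2_poly_op p (wshift w) u m)) {..<?P} \<le> l2norm (l2_poly_op p (wshift w) u)"
      unfolding L2_set_def
      using sum_power2_cmod_le_suminf[OF pu, of "{..<?P}"] l2norm_nonneg[OF pu]
      by (intro real_le_lsqrt) auto
    also have "\<dots> \<le> ?M * l2norm u" by (rule l2norm_le_opnorm[OF l2_bounded_op_poly[OF op] u(1)])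
    also have "\<dots> \<le> ?M * sqrt W" using u(2) M0 by (rule mult_left_mono)
    finally show "L2_set (\<lambda>m. cmod (l2_poly_op p (wshift w) u m)) {..<?P} \<le> ?M * sqrt W" .
  qed (rule L2_set_nonneg)
  finally have WW: "sqrt W * sqrt W \<le> sqrt W * (?M * L2_set (\<lambda>m. cmod (y m)) {..<?P})"
    using W0 by (simp add: mult_ac)
  \<comment> \<open>Cauchy--Schwarz has produced \<open>W\<close> on the left and
    \<open>sqrt W\<close> on the right; one root is cancelled.\<close>
  have "sqrt W \<le> ?M * L2_set (\<lambda>m. cmod (y m)) {..<?P}"
  proof (cases "W = 0")
    case True
    then show ?thesis using M0 L2_set_nonneg by simp
  next
    case False
    then show ?thesis using mult_left_le_imp_le[OF WW] W0 by simp
  qed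
  then have "(sqrt W)\<^sup>2 \<le> (?M * L2_set (\<lambda>m. cmod (y m)) {..<?P})\<^sup>2"
    using W0 by (intro power_mono) auto
  then have "W \<le> ?M\<^sup>2 * (\<Sum>n<?P. (cmod (y n))\<^sup>2)"
    using W0 by (simp add: power_mult_distrib L2_set_def sum_nonneg)
  moreover have "W = (\<Sum>n\<le>N. (1 / (\<beta> n)\<^sup>2) * (cmod (\<Sum>i\<le>degree p. coeff p i * x (n + i)))\<^sup>2)"
    unfolding W_def u_def by (intro sum.cong refl) (simp add: norm_divide power_divide del: cnj_sum)
  moreover have "(\<Sum>n<?P. (cmod (y n))\<^sup>2) = (\<Sum>n<?P. (1 / (\<beta> n)\<^sup>2) * (cmod (x n))\<^sup>2)"
    unfolding y_def by (intro sum.cong refl) (simp add: norm_divide power_divide)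
  ultimately show ?thesis by simp
qed

section \<open>Kaluza's lemma and the truncated renewal identity\<close>

text \<open>The assumption \<open>ratio\<close> is logarithmic convexity of \<open>b\<close>. The
  sign follows by induction from two consecutive convolution relations; once all signs are known,
  dropping the nonpositive middle terms gives the lower bound.\<close>

lemma kaluza_sign:
  fixes b \<gamma> :: "nat \<Rightarrow> real"
  assumes b0: "b 0 = 1" and bpos: "\<And>n. 0 < b n"
    and ratio: "\<And>j n. j \<le> n \<Longrightarrow> b (Suc j) * b n \<le> b (Suc n) * b j"
    and conv: "\<And>k. (\<Sum>i\<le>k. \<gamma> i * b (k - i)) = (if k = 0 then 1 else 0)"
  shows "0 < n \<Longrightarrow> \<gamma> n \<le> 0" "0 < n \<Longrightarrow> - b n \<le> \<gamma> n"
proof -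
  have g0: "\<gamma> 0 = 1" using conv[of 0] b0 by simp
  have conv': "(\<Sum>i\<in>{1..k}. \<gamma> i * b (k - i)) = - b k" if "0 < k" for k
    using conv[of k] that g0 by (simp add: atMost_atLeast0 sum.atLeast_Suc_atMost)
  have neg: "\<gamma> n \<le> 0" if "0 < n" for n
    using that
  proof (induction n rule: less_induct)
    case (less n)
    then obtain k where n: "n = Suc k" by (cases n) auto
    show ?case
    proof (cases "k = 0")
      case True
      then show ?thesis using conv'[of 1] bpos[of 1] b0 n by simp
    next
      case False
      have e: "\<gamma> n + (\<Sum>i\<in>{1..k}. \<gamma> i * b (n - i)) = - b n"
        using conv'[of n] n b0 by simp
      \<comment> \<open>The relation at \<open>k\<close>, multiplied by \<open>b n\<close>, is
        compared with the one at \<open>n = Suc k\<close>: since the earlier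
        \<open>\<gamma> i\<close> are nonpositive, passing to the smaller factors
        \<open>b (n - i) * b k\<close> can only raise the sum.\<close>
      have "b n * (- b k) = (\<Sum>i\<in>{1..k}. \<gamma> i * (b n * b (k - i)))"
        unfolding conv'[OF False[unfolded neq0_conv], symmetric] sum_distrib_left
        by (simp add: mult_ac)
      also have "\<dots> \<le> (\<Sum>i\<in>{1..k}. \<gamma> i * (b (n - i) * b k))"
      proof (rule sum_mono)
        fix i assume i: "i \<in> {1..k}"
        then have "\<gamma> i \<le> 0" using less.IH[of i] n by simp
        moreover have "b (n - i) * b k \<le> b n * b (k - i)"
          using ratio[of "k - i" k] i n by (simp add: Suc_diff_le)
        ultimately show "\<gamma> i * (b n * b (k - i)) \<le> \<gamma> i * (b (n - i) * b k)"
          by (rule mult_left_mono_neg[rotated])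
      qed
      also have "\<dots> = b k * (- b n - \<gamma> n)"
        using e[symmetric] by (simp add: sum_distrib_left mult_ac)
      finally have "b k * \<gamma> n \<le> 0" by (simp add: algebra_simps)
      then show ?thesis using bpos[of k] by (simp add: mult_le_0_iff)
    qed
  qed
  show "\<gamma> n \<le> 0" if "0 < n" using neg[OF that] .
  show "- b n \<le> \<gamma> n" if "0 < n"
  proof -
    obtain k where n: "n = Suc k" using \<open>0 < n\<close> by (cases n) auto
    have "(\<Sum>i\<in>{1..k}. \<gamma> i * b (n - i)) \<le> 0"
      using neg bpos by (intro sum_nonpos mult_nonpos_nonneg) (auto simp: less_imp_le)
    then show ?thesis using conv'[OF that] n b0 by simp
  qed
qed

text \<open>Finite form of the identity that the sum of \<open>b\<^sub>n q(T\<^sup>n x)\<close> is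
  the squared norm of \<open>x\<close>. Pairs with \<open>m + n \<le> P\<close> collapse to
  \<open>t 0\<close> by the convolution relation. The others have nonpositive weights, whence the
  upper bound; on the diagonal \<open>m + n = k\<close> their total is at least
  \<open>- b k\<close>, whence the lower one.\<close>

lemma renewal_sum_bounds:
  fixes b \<gamma> t :: "nat \<Rightarrow> real"
  assumes b0: "b 0 = 1" and bpos: "\<And>n. 0 < b n"
    and conv: "\<And>k. (\<Sum>i\<le>k. \<gamma> i * b (k - i)) = (if k = 0 then 1 else 0)"
    and neg: "\<And>n. 0 < n \<Longrightarrow> \<gamma> n \<le> 0"
    and t: "\<And>n. 0 \<le> t n" "\<And>n. t n \<le> B" and PL: "P \<le> L"
  shows "(\<Sum>n\<le>P. b n * (\<Sum>m\<le>L. \<gamma> m * t (n + m))) \<le> t 0"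
    and "t 0 - B * (\<Sum>k\<in>{P<..P+L}. b k) \<le> (\<Sum>n\<le>P. b n * (\<Sum>m\<le>L. \<gamma> m * t (n + m)))"
proof -
  define q where "q x = (case x of (m, n) \<Rightarrow> \<gamma> m * b n)" for x
  define Q1 where "Q1 = {(m, n). m + n \<le> P}"
  define Q2 where "Q2 = {(m, n). m \<le> L \<and> n \<le> P \<and> P < m + n}"
  have fin: "finite Q1" "finite Q2"
    unfolding Q1_def Q2_def
    by (auto intro: finite_subset[of _ "{..P} \<times> {..P}"] finite_subset[of _ "{..L} \<times> {..P}"])
  have "(\<Sum>n\<le>P. b n * (\<Sum>m\<le>L. \<gamma> m * t (n + m)))
      = (\<Sum>m\<le>L. \<Sum>n\<le>P. q (m, n) * t (m + n))"
    unfolding sum_distrib_left by (subst sum.swap) (simp add: q_def mult_ac add.commute)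
  also have "\<dots> = (\<Sum>x\<in>{..L} \<times> {..P}. q x * t (fst x + snd x))"
    by (simp add: sum.cartesian_product case_prod_unfold)
  \<comment> \<open>\<open>P \<le> L\<close> places the whole triangle \<open>Q1\<close> inside the
    rectangle.\<close>
  also have "{..L} \<times> {..P} = Q1 \<union> Q2"
    using PL by (auto simp: Q1_def Q2_def)
  also have "(\<Sum>x\<in>Q1 \<union> Q2. q x * t (fst x + snd x))
      = (\<Sum>x\<in>Q1. q x * t (fst x + snd x)) + (\<Sum>x\<in>Q2. q x * t (fst x + snd x))"
    by (rule sum.union_disjoint) (use fin in \<open>auto simp: Q1_def Q2_def\<close>)
  also have "(\<Sum>x\<in>Q1. q x * t (fst x + snd x)) = (\<Sum>k\<le>P. (\<Sum>i\<le>k. \<gamma> i * b (k - i)) * t k)"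
    unfolding Q1_def using sum.triangle_reindex_eq[of "\<lambda>m n. \<gamma> m * b n * t (m + n)" P]
    by (simp add: q_def case_prod_unfold sum_distrib_right)
  also have "\<dots> = t 0"
    unfolding conv by (simp add: if_distrib[of "\<lambda>x. x * _"] cong: if_cong)
  finally have S: "(\<Sum>n\<le>P. b n * (\<Sum>m\<le>L. \<gamma> m * t (n + m))) = t 0 + (\<Sum>x\<in>Q2. q x * t (fst x + snd x))" .
  have q2: "q x \<le> 0" if "x \<in> Q2" for x
  proof -
    obtain m n where x: "x = (m, n)" by fastforce
    then have "0 < m" using that by (auto simp: Q2_def)
    then show ?thesis using neg[of m] bpos[of n] x by (simp add: q_def mult_nonpos_nonneg less_imp_le)
  qed
  have "(\<Sum>x\<in>Q2. q x * t (fst x + snd x)) \<le> 0"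
    using q2 t(1) by (intro sum_nonpos mult_nonpos_nonneg)
  then show "(\<Sum>n\<le>P. b n * (\<Sum>m\<le>L. \<gamma> m * t (n + m))) \<le> t 0" using S by simp
  have B0: "0 \<le> B" using t[of 0] by simp
  have "(\<Sum>x\<in>Q2. - q x) = (\<Sum>y\<in>(\<lambda>(m, n). (m + n, m)) ` Q2. - (\<gamma> (snd y) * b (fst y - snd y)))"
    by (subst sum.reindex) (auto simp: inj_on_def q_def case_prod_unfold)
  \<comment> \<open>In coordinates \<open>(m + n, m)\<close> the set \<open>Q2\<close> is enlarged
    to full diagonals, on which the convolution relation evaluates the sum; the added terms are
    nonnegative.\<close>
  also have "\<dots> \<le> (\<Sum>y\<in>(SIGMA k:{P<..P+L}. {1..k}). - (\<gamma> (snd y) * b (fst y - snd y)))"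
  proof (rule sum_mono2)
    fix y assume "y \<in> (SIGMA k:{P<..P+L}. {1..k}) - (\<lambda>(m, n). (m + n, m)) ` Q2"
    then show "0 \<le> - (\<gamma> (snd y) * b (fst y - snd y))"
      using neg[of "snd y"] bpos[of "fst y - snd y"]
      by (auto simp: mult_le_0_iff)
  qed (auto simp: Q2_def)
  also have "\<dots> = (\<Sum>k\<in>{P<..P+L}. \<Sum>i\<in>{1..k}. - (\<gamma> i * b (k - i)))"
    by (subst sum.Sigma) (auto simp: case_prod_unfold)
  also have "\<dots> = (\<Sum>k\<in>{P<..P+L}. b k)"
  proof (rule sum.cong)
    fix k assume "k \<in> {P<..P+L}"
    then show "(\<Sum>i\<in>{1..k}. - (\<gamma> i * b (k - i))) = b k"
      using conv[of k] conv[of 0] b0 by (simp add: atMost_atLeast0 sum.atLeast_Suc_atMost sum_negf)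
  qed simp
  finally have tail: "(\<Sum>x\<in>Q2. - q x) \<le> (\<Sum>k\<in>{P<..P+L}. b k)" .
  have "(\<Sum>x\<in>Q2. - q x * t (fst x + snd x)) \<le> (\<Sum>x\<in>Q2. - q x * B)"
    using q2 t(2) by (intro sum_mono mult_left_mono) auto
  also have "\<dots> = B * (\<Sum>x\<in>Q2. - q x)"
    by (simp add: sum_distrib_left mult.commute)
  also have "\<dots> \<le> B * (\<Sum>k\<in>{P<..P+L}. b k)"
    using tail B0 by (rule mult_left_mono)
  finally show "t 0 - B * (\<Sum>k\<in>{P<..P+L}. b k) \<le> (\<Sum>n\<le>P. b n * (\<Sum>m\<le>L. \<gamma> m * t (n + m)))"
    using S by (simp add: sum_negf)
qed

text \<open>Telescoping comparison of \<open>1 / k\<^sup>2\<close> with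
  \<open>1 / (k - 1) - 1 / k\<close>.\<close>

lemma sum_inverse_squares_le:
  assumes "0 < N"
  shows "(\<Sum>k\<in>{N<..N+L}. 1 / (real k)\<^sup>2) \<le> 1 / real N - 1 / real (N + L)"
proof (induction L)
  case (Suc L)
  have "{N<..N + Suc L} = insert (Suc (N + L)) {N<..N+L}" by auto
  then have "(\<Sum>k\<in>{N<..N + Suc L}. 1 / (real k)\<^sup>2) = 1 / (real (Suc (N + L)))\<^sup>2 + (\<Sum>k\<in>{N<..N+L}. 1 / (real k)\<^sup>2)"
    by simp
  moreover have "1 / (real (Suc (N + L)))\<^sup>2 \<le> 1 / real (N + L) - 1 / real (Suc (N + L))"
  proof -
    define x where "x = real (N + L)"
    have x: "0 < x" using assms by (simp add: x_def)
    have "1 / x - 1 / (x + 1) = 1 / (x * (x + 1))" using x by (simp add: field_simps)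
    moreover have "1 / (x + 1)\<^sup>2 \<le> 1 / (x * (x + 1))"
      using x by (intro divide_left_mono) (auto simp: power2_eq_square)
    moreover have "real (Suc (N + L)) = x + 1" by (simp add: x_def)
    ultimately show ?thesis unfolding x_def[symmetric] by (simp only:)
  qed
  ultimately show ?case using Suc by simp
qed simp

section \<open>Inner products along the orbit of an operator\<close>

lemma cinner_0_left: "cinner 0 (y::'a::complex_inner) = 0"
  using cinner_add_left[of 0 0 y] by simp

lemma cinner_sum_left:
  "cinner (\<Sum>i\<in>I. f i) (y::'a::complex_inner) = (\<Sum>i\<in>I. cinner (f i) y)"
  by (induction I rule: infinite_finite_induct) (simp_all add: cinner_0_left cinner_add_left)

lemma cinner_sum_right:
  "cinner (y::'a::complex_inner) (\<Sum>i\<in>I. f i) = (\<Sum>i\<in>I. cinner y (f i))"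
  unfolding cinner_commute[of y] cinner_sum_left cnj_sum ..

lemma cinner_scaleC_right: "cinner x (scaleC c y) = c * cinner x (y::'a::complex_inner)"
  unfolding cinner_commute[of x] cinner_scaleC_left by simp

lemma power2_norm_eq_cinner: "(norm (x::'a::complex_inner))\<^sup>2 = Re (cinner x x)"
  by (simp add: norm_eq_sqrt_cinner cinner_ge_zero)

lemma power2_norm_sum_scaleC:
  fixes v :: "'i \<Rightarrow> 'a::complex_inner"
  shows "(norm (\<Sum>i\<in>I. scaleC (a i) (v i)))\<^sup>2
    = Re (\<Sum>i\<in>I. \<Sum>j\<in>I. cnj (a i) * a j * cinner (v i) (v j))"
  unfolding power2_norm_eq_cinner cinner_sum_left
  unfolding cinner_sum_right cinner_scaleC_left cinner_scaleC_right by (simp only: mult_ac)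

lemma bounded_clinear_funpow:
  assumes "bounded_clinear T"
  shows "bounded_clinear (T ^^ n)"
proof (induction n)
  case 0
  show ?case by (simp add: bounded_clinear_def id_def[symmetric] bounded_linear_ident[folded id_def])
next
  case (Suc n)
  then show ?case using assms bounded_linear_compose[of T "T ^^ n"]
    by (auto simp: bounded_clinear_def o_def)
qed

lemma bounded_clinear_sum_scaleC:
  assumes "bounded_clinear T"
  shows "T (\<Sum>i\<in>I. scaleC (a i) (v i)) = (\<Sum>i\<in>I. scaleC (a i) (T (v i)))"
  using assms bounded_linear.linear[of T] by (simp add: bounded_clinear_def linear_sum)

lemma power_bounded_norm_le:
  assumes T: "bounded_clinear T" and K: "\<And>n. onorm (T ^^ n) \<le> K"
  shows "norm ((T ^^ n) x) \<le> K * norm x"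
proof -
  have "bounded_linear (T ^^ n)"
    using bounded_clinear_funpow[OF T] by (simp add: bounded_clinear_def)
  then have "norm ((T ^^ n) x) \<le> onorm (T ^^ n) * norm x" by (rule onorm)
  also have "\<dots> \<le> K * norm x" using K by (rule mult_right_mono) simp
  finally show ?thesis .
qed

text \<open>Identifies the form of the Gram matrix with \<open>q\<close> at a polynomial in
  \<open>T\<close> applied to \<open>h\<close>. With \<open>n = 0\<close> it yields positivity of
  that matrix; with the coefficients of \<open>p\<close> it yields
  \<open>q(T\<^sup>n p(T) h)\<close>.\<close>

lemma weighted_gram_form:
  fixes h :: "'a::complex_inner"
  assumes T: "bounded_clinear T"
  shows "Re (\<Sum>r\<in>I. \<Sum>s\<in>I. cnj (a r) * a s *
      (\<Sum>m\<in>J. complex_of_real (\<gamma> m) * cinner ((T ^^ (n + r + m)) h) ((T ^^ (n + s + m)) h)))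
    = (\<Sum>m\<in>J. \<gamma> m * (norm ((T ^^ (n + m)) (\<Sum>r\<in>I. scaleC (a r) ((T ^^ r) h))))\<^sup>2)"
proof -
  let ?c = "\<lambda>m r s. cnj (a r) * a s * cinner ((T ^^ (n + r + m)) h) ((T ^^ (n + s + m)) h)"
  have sq: "(norm ((T ^^ (n + m)) (\<Sum>r\<in>I. scaleC (a r) ((T ^^ r) h))))\<^sup>2 = Re (\<Sum>r\<in>I. \<Sum>s\<in>I. ?c m r s)" for m
  proof -
    have "(T ^^ (n + m)) ((T ^^ r) h) = (T ^^ (n + r + m)) h" for r
      by (simp add: funpow_add[symmetric] flip: o_apply[of "T ^^ (n + m)" "T ^^ r" h]) (simp add: ac_simps)
    then show ?thesis
      unfolding bounded_clinear_sum_scaleC[OF bounded_clinear_funpow[OF T]] power2_norm_sum_scaleC by simp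
  qed
  have "(\<Sum>r\<in>I. \<Sum>s\<in>I. cnj (a r) * a s *
      (\<Sum>m\<in>J. complex_of_real (\<gamma> m) * cinner ((T ^^ (n + r + m)) h) ((T ^^ (n + s + m)) h)))
    = (\<Sum>r\<in>I. \<Sum>s\<in>I. \<Sum>m\<in>J. complex_of_real (\<gamma> m) * ?c m r s)"
    by (simp add: sum_distrib_left mult_ac)
  also have "\<dots> = (\<Sum>r\<in>I. \<Sum>m\<in>J. \<Sum>s\<in>I. complex_of_real (\<gamma> m) * ?c m r s)"
    by (rule sum.cong[OF refl], rule sum.swap)
  also have "\<dots> = (\<Sum>m\<in>J. \<Sum>r\<in>I. \<Sum>s\<in>I. complex_of_real (\<gamma> m) * ?c m r s)"
    by (rule sum.swap)
  also have "\<dots> = (\<Sum>m\<in>J. complex_of_real (\<gamma> m) * (\<Sum>r\<in>I. \<Sum>s\<in>I. ?c m r s))"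
    by (simp only: sum_distrib_left)
  finally have "Re (\<Sum>r\<in>I. \<Sum>s\<in>I. cnj (a r) * a s *
      (\<Sum>m\<in>J. complex_of_real (\<gamma> m) * cinner ((T ^^ (n + r + m)) h) ((T ^^ (n + s + m)) h)))
    = Re (\<Sum>m\<in>J. complex_of_real (\<gamma> m) * (\<Sum>r\<in>I. \<Sum>s\<in>I. ?c m r s))"
    by (rule arg_cong)
  moreover have "Re (\<Sum>m\<in>J. complex_of_real (\<gamma> m) * C m) = (\<Sum>m\<in>J. \<gamma> m * Re (C m))" for C
    by simp
  ultimately show ?thesis unfolding sq by (simp only:)
qed

lemma sum_inverse_squares_le_2: "(\<Sum>k\<in>{0<..L}. 1 / (real k)\<^sup>2) \<le> 2"
proof (cases L)
  case (Suc l)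
  have "{0<..L} = insert 1 {1<..1+l}" using Suc by auto
  moreover have "(\<Sum>k\<in>{1<..1+l}. 1 / (real k)\<^sup>2) \<le> 1"
    by (rule order_trans[OF sum_inverse_squares_le]) simp_all
  ultimately show ?thesis by simp
qed simp

section \<open>Von Neumann type inequality for \<open>S_K\<close>\<close>

lemma l2_bounded_op_S_K:
  assumes K: "1 < K"
  shows "l2_bounded_op (S_K K)"
  unfolding S_K_def
proof (rule l2_bounded_op_wshift)
  fix s
  \<comment> \<open>For \<open>s \<ge> 1\<close> the largest weight is
    \<open>alphaK K 1 = 2 * K + 1\<close>; the bound must also cover index 0, where the formula
    gives \<open>1 / (1 - 2 * K)\<close>.\<close>
  have "\<bar>alphaK K s\<bar> \<le> max \<bar>alphaK K 0\<bar> (2 * K + 1)"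
  proof (cases s)
    case (Suc n)
    have pos: "0 < 2 * K * real n + 1" using K by (simp add: add_nonneg_pos)
    have "0 \<le> K * (K * real n)" "0 \<le> K * real n" using K by simp_all
    then have "(2 * K * real (Suc n) + 1) / (2 * K * real n + 1) \<le> 2 * K + 1"
      using pos by (simp add: divide_le_eq) (simp add: algebra_simps)
    moreover have "0 \<le> (2 * K * real (Suc n) + 1) / (2 * K * real n + 1)"
      using pos K by simp
    moreover have "alphaK K s = (2 * K * real (Suc n) + 1) / (2 * K * real n + 1)"
      by (simp add: Suc alphaK_def)
    ultimately show ?thesis by linarith
  qed simp
  then show "cmod (complex_of_real (alphaK K s)) \<le> max \<bar>alphaK K 0\<bar> (2 * K + 1)"
    by (simp only: norm_of_real)
qed

text \<open>With \<open>y = p(T) h\<close>, the chain is: squared norm of \<open>y\<close> minus a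
  tail, at most the \<open>b\<close>-weighted sum of \<open>q(T\<^sup>n y)\<close>, at most
  \<open>M\<^sup>2\<close> times the same sum for \<open>h\<close>, at most \<open>M\<^sup>2\<close>
  times the squared norm of \<open>h\<close>. The tail vanishes in the limit.\<close>

lemma power_bounded_poly_le:
  fixes T :: "'a::complex_inner \<Rightarrow> 'a"
  assumes K: "1 < K" and T: "bounded_clinear T" and TK: "\<And>n. onorm (T ^^ n) \<le> K"
  shows "norm (cpoly_op p T h) \<le> l2_opnorm (l2_poly_op p (S_K K)) * norm h"
proof -
  \<comment> \<open>The telescoping product of the first \<open>n\<close> weights of
    \<open>S_K\<close>.\<close>
  define \<beta> where "\<beta> n = 2 * K * real n + 1" for n
  define b where "b n = 1 / (\<beta> n)\<^sup>2" for n
  define \<gamma> where "\<gamma> = fps_nth (inverse (Abs_fps b))"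
  have \<beta>: "0 < \<beta> n" for n using K by (simp add: \<beta>_def add_nonneg_pos)
  have b0: "b 0 = 1" by (simp add: b_def \<beta>_def)
  have bpos: "0 < b n" for n using \<beta>[of n] by (simp add: b_def)
  have ratio: "b (Suc j) * b n \<le> b (Suc n) * b j" if "j \<le> n" for j n
  proof -
    have "K * (K * real j) \<le> K * (K * real n)"
      using that K by (intro mult_left_mono) auto
    then have "\<beta> (Suc n) * \<beta> j \<le> \<beta> (Suc j) * \<beta> n"
      using that K by (simp add: \<beta>_def algebra_simps)
    then have "(\<beta> (Suc n) * \<beta> j)\<^sup>2 \<le> (\<beta> (Suc j) * \<beta> n)\<^sup>2"
      by (rule power_mono) (simp add: \<beta> less_imp_le)
    then have "1 / (\<beta> (Suc j) * \<beta> n)\<^sup>2 \<le> 1 / (\<beta> (Suc n) * \<beta> j)\<^sup>2"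
      using \<beta>[of "Suc n"] \<beta>[of j] \<beta>[of "Suc j"] \<beta>[of n] by (intro divide_left_mono) auto
    then show ?thesis by (simp add: b_def power_mult_distrib)
  qed
  have conv: "(\<Sum>i\<le>k. \<gamma> i * b (k - i)) = (if k = 0 then 1 else 0)" for k
  proof -
    have "inverse (Abs_fps b) * Abs_fps b = 1"
      by (rule inverse_mult_eq_1) (simp add: b0)
    then have "fps_nth (inverse (Abs_fps b) * Abs_fps b) k = fps_nth 1 k" by simp
    then show ?thesis by (simp add: fps_mult_nth \<gamma>_def atMost_atLeast0)
  qed
  note neg = kaluza_sign(1)[of b \<gamma>, OF b0 bpos ratio conv]
  note low = kaluza_sign(2)[of b \<gamma>, OF b0 bpos ratio conv]
  \<comment> \<open>The factor \<open>2 * K\<close> in the weights pays off here: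
    \<open>4 * K\<^sup>2\<close> in the denominator absorbs the \<open>K\<^sup>2\<close> coming from
    the power bound.\<close>
  have bsq: "b n \<le> 1 / (4 * K\<^sup>2) * (1 / (real n)\<^sup>2)" if "0 < n" for n
  proof -
    have "(2 * K * real n)\<^sup>2 \<le> (\<beta> n)\<^sup>2"
      using K by (intro power_mono) (auto simp: \<beta>_def)
    then have "b n \<le> 1 / (2 * K * real n)\<^sup>2"
      unfolding b_def using K that \<beta>[of n] by (intro divide_left_mono) auto
    then show ?thesis by (simp add: power_mult_distrib)
  qed
  have bsq1: "b n \<le> 1 / (real n)\<^sup>2" if "0 < n" for n
  proof -
    have "1 \<le> 4 * K\<^sup>2" using K one_le_power[of K 2] by linarith
    then have "1 / (4 * K\<^sup>2) \<le> 1" using divide_le_eq_1_pos[of "4 * K\<^sup>2" 1] by linarith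
    then have "1 / (4 * K\<^sup>2) * (1 / (real n)\<^sup>2) \<le> 1 * (1 / (real n)\<^sup>2)"
      by (rule mult_right_mono) simp
    then show ?thesis using bsq[OF that] by simp
  qed
  have g0: "\<gamma> 0 = 1" using conv[of 0] b0 by simp
  \<comment> \<open>Positivity of \<open>q\<close>, cut off at \<open>L\<close>: the terms with
    \<open>m > 0\<close> amount to at most \<open>K\<^sup>2 * 2 / (4 * K\<^sup>2) = 1/2\<close> of
    the leading term.\<close>
  have pos: "0 \<le> (\<Sum>m\<le>L. \<gamma> m * (norm ((T ^^ m) u))\<^sup>2)" for L u
  proof -
    have "(\<Sum>m\<in>{0<..L}. - \<gamma> m * (norm ((T ^^ m) u))\<^sup>2)
      \<le> (\<Sum>m\<in>{0<..L}. (1 / (4 * K\<^sup>2) * (1 / (real m)\<^sup>2)) * (K * norm u)\<^sup>2)"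
    proof (rule sum_mono)
      fix m assume m: "m \<in> {0<..L}"
      show "- \<gamma> m * (norm ((T ^^ m) u))\<^sup>2 \<le> (1 / (4 * K\<^sup>2) * (1 / (real m)\<^sup>2)) * (K * norm u)\<^sup>2"
        using m low[of m] bsq[of m] power_bounded_norm_le[OF T TK, of m u]
        by (intro mult_mono power_mono) auto
    qed
    also have "\<dots> = (K * norm u)\<^sup>2 / (4 * K\<^sup>2) * (\<Sum>m\<in>{0<..L}. 1 / (real m)\<^sup>2)"
      unfolding sum_distrib_left by (intro sum.cong refl) simp
    also have "\<dots> \<le> (K * norm u)\<^sup>2 / (4 * K\<^sup>2) * 2"
      by (intro mult_left_mono sum_inverse_squares_le_2) auto
    also have "\<dots> \<le> (norm u)\<^sup>2" using K by (simp add: power_mult_distrib)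
    finally have "(\<Sum>m\<in>{0<..L}. - \<gamma> m * (norm ((T ^^ m) u))\<^sup>2) \<le> (norm u)\<^sup>2" .
    moreover have "{..L} = insert 0 {0<..L}" by auto
    ultimately show ?thesis by (simp add: g0 sum_negf)
  qed
  define w where "w s = complex_of_real (alphaK K s)" for s
  have S: "S_K K = wshift w" by (simp add: S_K_def w_def[abs_def])
  have ws: "w (Suc n) = complex_of_real (\<beta> (Suc n) / \<beta> n)" for n
    by (simp add: w_def alphaK_def \<beta>_def)
  have op: "l2_bounded_op (wshift w)" using l2_bounded_op_S_K[OF K] by (simp add: S)
  define M where "M = l2_opnorm (l2_poly_op p (wshift w))"
  have M0: "0 \<le> M" unfolding M_def by (rule l2_opnorm_nonneg[OF l2_bounded_op_poly[OF op]])
  let ?d = "degree p"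
  define y where "y = cpoly_op p T h"
  define B where "B = (K * norm y)\<^sup>2"
  have main: "(norm y)\<^sup>2 - B * (1 / real N) \<le> M\<^sup>2 * (norm h)\<^sup>2" if N: "0 < N" for N
  proof -
    \<comment> \<open>One cut-off serves two purposes: it is the largest Gram index
      \<open>n + i\<close> that occurs, and the length of the truncated form
      \<open>q\<close>.\<close>
    define L where "L = N + ?d"
    define G where "G r s = (\<Sum>m\<le>L. complex_of_real (\<gamma> m) * cinner ((T ^^ (r + m)) h) ((T ^^ (s + m)) h))" for r s
    have herm: "G r s = cnj (G s r)" for r s
      unfolding G_def cnj_sum by (intro sum.cong refl) (simp add: cinner_commute[symmetric])
    have psd: "0 \<le> Re (\<Sum>r<Suc L. \<Sum>s<Suc L. cnj (a r) * a s * G r s)" for a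
      using weighted_gram_form[OF T, where I = "{..<Suc L}" and J = "{..L}" and a = a and \<gamma> = \<gamma> and n = 0 and h = h] pos
      by (simp only: G_def add_0)
    have diag: "Re (G n n) = (\<Sum>m\<le>L. \<gamma> m * (norm ((T ^^ (n + m)) h))\<^sup>2)" for n
      by (simp add: G_def power2_norm_eq_cinner)
    have row: "Re (\<Sum>i\<le>?d. \<Sum>j\<le>?d. cnj (coeff p i) * coeff p j * G (n + i) (n + j))
        = (\<Sum>m\<le>L. \<gamma> m * (norm ((T ^^ (n + m)) y))\<^sup>2)" for n
      unfolding G_def y_def cpoly_op_def by (rule weighted_gram_form[OF T])
    have amp: "(\<Sum>n\<le>N. b n * (\<Sum>m\<le>L. \<gamma> m * (norm ((T ^^ (n + m)) y))\<^sup>2))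
        \<le> M\<^sup>2 * (\<Sum>n<Suc L. b n * (\<Sum>m\<le>L. \<gamma> m * (norm ((T ^^ (n + m)) h))\<^sup>2))"
      unfolding row[symmetric] diag[symmetric]
    proof (rule psd_amplification[OF herm psd])
      show "(\<Sum>n\<le>N. b n * (cmod (\<Sum>i\<le>?d. coeff p i * x (n + i)))\<^sup>2)
          \<le> M\<^sup>2 * (\<Sum>n<Suc L. b n * (cmod (x n))\<^sup>2)" for x
        unfolding b_def M_def L_def by (rule wshift_adjoint_bound[OF op \<beta> ws])
    qed (simp add: L_def)
    have t: "(norm ((T ^^ n) x))\<^sup>2 \<le> (K * norm x)\<^sup>2" for n x
      using power_bounded_norm_le[OF T TK, of n x] by (intro power_mono) auto
    have "(\<Sum>k\<in>{N<..N+L}. b k) \<le> (\<Sum>k\<in>{N<..N+L}. 1 / (real k)\<^sup>2)"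
      using bsq1 by (intro sum_mono) auto
    also have "\<dots> \<le> 1 / real N" using sum_inverse_squares_le[OF N, of L]
      by (smt (verit) divide_nonneg_nonneg of_nat_0_le_iff)
    finally have "B * (\<Sum>k\<in>{N<..N+L}. b k) \<le> B * (1 / real N)"
      by (intro mult_left_mono) (auto simp: B_def)
    then have "(norm y)\<^sup>2 - B * (1 / real N) \<le> (norm y)\<^sup>2 - B * (\<Sum>k\<in>{N<..N+L}. b k)" by simp
    also have "\<dots> \<le> (\<Sum>n\<le>N. b n * (\<Sum>m\<le>L. \<gamma> m * (norm ((T ^^ (n + m)) y))\<^sup>2))"
      using renewal_sum_bounds(2)[of b \<gamma> "\<lambda>n. (norm ((T ^^ n) y))\<^sup>2" B N L, OF b0 bpos conv neg _ t[of _ y, folded B_def]]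
      by (simp add: L_def)
    also have "\<dots> \<le> M\<^sup>2 * (\<Sum>n<Suc L. b n * (\<Sum>m\<le>L. \<gamma> m * (norm ((T ^^ (n + m)) h))\<^sup>2))"
      by (rule amp)
    also have "\<dots> \<le> M\<^sup>2 * (norm h)\<^sup>2"
      using renewal_sum_bounds(1)[of b \<gamma> "\<lambda>n. (norm ((T ^^ n) h))\<^sup>2" _ L L, OF b0 bpos conv neg _ t[of _ h]]
      by (intro mult_left_mono) (simp_all add: lessThan_Suc_atMost)
    finally show ?thesis .
  qed
  have "(\<lambda>N. (norm y)\<^sup>2 - B * (1 / real N)) \<longlonglongrightarrow> (norm y)\<^sup>2 - B * 0"
    by (intro tendsto_intros lim_1_over_n)
  then have "(norm y)\<^sup>2 - B * 0 \<le> M\<^sup>2 * (norm h)\<^sup>2"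
    by (rule LIMSEQ_le_const2) (use main in \<open>auto intro!: exI[of _ 1]\<close>)
  then have "(norm y)\<^sup>2 \<le> (M * norm h)\<^sup>2" by (simp add: power_mult_distrib)
  then have "norm y \<le> M * norm h" by (rule power2_le_imp_le) (simp add: M0)
  then show ?thesis by (simp add: y_def M_def S)
qed

section \<open>Foguel operators\<close>

text \<open>
  Foguel's operator on \<open>\<ell>\<^sup>2 \<oplus> \<ell>\<^sup>2\<close>, with the two summands interleaved: the even coordinates carry the
  forward shift, the odd ones the backward shift, and \<open>\<epsilon>\<close> times the projection onto the coordinates in
  \<open>J\<close> maps the former to the latter.
\<close>

definition foguel :: "real \<Rightarrow> nat set \<Rightarrow> (nat \<Rightarrow> complex) \<Rightarrow> (nat \<Rightarrow> complex)" where
  "foguel \<epsilon> J z n =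
     (if even n then (if n = 0 then 0 else z (n - 2))
      else z (n + 2) + (if n div 2 \<in> J then complex_of_real \<epsilon> * z (n - 1) else 0))"

text \<open>
  The forward shift is applied \<open>t\<close> times, the coupling once at position \<open>l + n - Suc t\<close>, and the backward
  shift \<open>n - Suc t\<close> times, ending at position \<open>l\<close>.
\<close>

definition foguel_jumps :: "nat set \<Rightarrow> nat \<Rightarrow> nat \<Rightarrow> nat set" where
  "foguel_jumps J n l = {t. t < n \<and> Suc (2 * t) \<le> l + n \<and> l + n - Suc t \<in> J}"

lemma finite_foguel_jumps [simp]: "finite (foguel_jumps J n l)"
  by (simp add: foguel_jumps_def)

text \<open>The outermost application either couples at \<open>l\<close>, after \<open>n\<close>
  forward shifts, or moves back from \<open>l + 1\<close>.\<close>

lemma foguel_jumps_Suc: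
  "foguel_jumps J (Suc n) l =
     (if l \<in> J \<and> n \<le> l then {n} else {}) \<union> foguel_jumps J n (Suc l)"
  by (auto simp: foguel_jumps_def less_Suc_eq)

lemma foguel_funpow_even: "(foguel \<epsilon> J ^^ n) z (2 * m) = (if m < n then 0 else z (2 * (m - n)))"
proof (induction n arbitrary: m)
  case (Suc n)
  show ?case
  proof (cases m)
    case 0
    then show ?thesis by (simp add: foguel_def)
  next
    case (Suc m')
    then show ?thesis using Suc.IH[of m'] by (simp add: foguel_def)
  qed
qed simp

text \<open>Power of a block triangular operator: besides the power of the backward shift there is a
  corner term, a sum over the time \<open>t\<close> at which the coupling acts.\<close>

lemma foguel_funpow_odd:
  "(foguel \<epsilon> J ^^ n) z (Suc (2 * l)) =
     z (Suc (2 * (l + n))) + complex_of_real \<epsilon> * (\<Sum>t\<in>foguel_jumps J n l. z (2 * (l + n - Suc (2 * t))))"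
proof (induction n arbitrary: l)
  case 0
  then show ?case by (simp add: foguel_jumps_def)
next
  case (Suc n)
  have n: "n \<notin> foguel_jumps J n (Suc l)" by (simp add: foguel_jumps_def)
  have odd: "(foguel \<epsilon> J ^^ n) z (Suc (Suc (Suc (2 * l)))) =
    z (Suc (2 * (Suc l + n))) + complex_of_real \<epsilon> * (\<Sum>t\<in>foguel_jumps J n (Suc l). z (2 * (Suc l + n - Suc (2 * t))))"
    using Suc.IH[of "Suc l"] by simp
  have "(foguel \<epsilon> J ^^ Suc n) z (Suc (2 * l)) = (foguel \<epsilon> J ^^ n) z (Suc (Suc (Suc (2 * l))))
      + (if l \<in> J then complex_of_real \<epsilon> * (foguel \<epsilon> J ^^ n) z (2 * l) else 0)"
    by (simp add: foguel_def)
  also have "\<dots> = z (Suc (2 * (l + Suc n)))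
      + complex_of_real \<epsilon> * (\<Sum>t\<in>foguel_jumps J (Suc n) l. z (2 * (l + Suc n - Suc (2 * t))))"
    unfolding odd foguel_funpow_even foguel_jumps_Suc using n by (auto simp: algebra_simps)
  finally show ?case .
qed

lemma sum_even_odd: "(\<Sum>k<2 * N. g k) = (\<Sum>m<N. g (2 * m)) + (\<Sum>m<N. g (Suc (2 * m)))"
  for g :: "nat \<Rightarrow> 'b::comm_monoid_add"
  by (induction N) (simp_all add: ac_simps)

lemma power2_sum_subsingleton:
  assumes "\<And>s t. s \<in> D \<Longrightarrow> t \<in> D \<Longrightarrow> s = t"
  shows "(cmod (\<Sum>t\<in>D. h t))\<^sup>2 = (\<Sum>t\<in>D. (cmod (h t))\<^sup>2)"
proof (cases "D = {}")
  case False
  then obtain t where "D = {t}" using assms by blast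
  then show ?thesis by simp
qed simp

text \<open>Cauchy--Schwarz with weights 1 and \<open>\<epsilon>\<close>; this split makes the
  constant in the power bound exactly \<open>1 + \<epsilon>\<close>.\<close>

lemma cmod_add_scaled_power2_le:
  assumes "0 \<le> \<epsilon>"
  shows "(cmod (u + complex_of_real \<epsilon> * v))\<^sup>2 \<le> (1 + \<epsilon>) * ((cmod u)\<^sup>2 + \<epsilon> * (cmod v)\<^sup>2)"
proof -
  have "cmod (u + complex_of_real \<epsilon> * v) \<le> cmod u + \<epsilon> * cmod v"
    using norm_triangle_ineq[of u "complex_of_real \<epsilon> * v"] assms by (simp add: norm_mult)
  then have "(cmod (u + complex_of_real \<epsilon> * v))\<^sup>2 \<le> (cmod u + \<epsilon> * cmod v)\<^sup>2"
    by (rule power_mono) simp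
  moreover have "(1 + \<epsilon>) * ((cmod u)\<^sup>2 + \<epsilon> * (cmod v)\<^sup>2) - (cmod u + \<epsilon> * cmod v)\<^sup>2
      = \<epsilon> * (cmod u - cmod v)\<^sup>2"
    by (simp add: power2_eq_square algebra_simps)
  moreover have "0 \<le> \<epsilon> * (cmod u - cmod v)\<^sup>2" using assms by simp
  ultimately show ?thesis by linarith
qed

text \<open>By the doubling gaps in \<open>J\<close>, the corner of the \<open>n\<close>-th power,
  without the factor \<open>\<epsilon>\<close>, is a 0-1 matrix with at most one 1 in each row and
  column, hence a contraction for every \<open>n\<close>.\<close>

lemma foguel_jump_norm_le:
  assumes J: "\<forall>j\<in>J. \<forall>j'\<in>J. j < j' \<longrightarrow> 2 * j < j'" and z: "z \<in> l2"
  shows "(\<Sum>l<N. (cmod (\<Sum>t\<in>foguel_jumps J n l. z (2 * (l + n - Suc (2 * t)))))\<^sup>2) \<le> (l2norm z)\<^sup>2"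
proof -
  \<comment> \<open>Rows: for a jump at position \<open>j = l + n - Suc t\<close> one has
    \<open>t \<le> j\<close>, so a jump from larger position in the same row sits at most at
    \<open>j + t \<le> 2 * j\<close>, which the gap forbids.\<close>
  have one: "s = t" if "s \<in> foguel_jumps J n l" "t \<in> foguel_jumps J n l" for s t l
  proof (rule ccontr)
    assume "s \<noteq> t"
    then show False
      using that J[rule_format, of "l + n - Suc s" "l + n - Suc t"] J[rule_format, of "l + n - Suc t" "l + n - Suc s"]
      unfolding foguel_jumps_def mem_Collect_eq by linarith
  qed
  define P where "P = (SIGMA l:{..<N}. foguel_jumps J n l)"
  define i where "i = (\<lambda>(l, t). 2 * (l + n - Suc (2 * t)))"
  \<comment> \<open>Columns: for a common source \<open>k\<close> the positions are
    \<open>k + t\<close> and \<open>k + t'\<close>; as \<open>t' < n \<le> k + 1 + 2 * t\<close>,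
    the larger is at most twice the smaller.\<close>
  have inj: "inj_on i P"
  proof (rule inj_onI)
    fix x y assume "x \<in> P" "y \<in> P" "i x = i y"
    moreover obtain l t l' t' where "x = (l, t)" "y = (l', t')" by fastforce
    ultimately have t: "t \<in> foguel_jumps J n l" "t' \<in> foguel_jumps J n l'"
      and eq: "l + n - Suc (2 * t) = l' + n - Suc (2 * t')" and xy: "x = (l, t)" "y = (l', t')"
      by (auto simp: P_def i_def)
    have "t = t'"
    proof (rule ccontr)
      assume "t \<noteq> t'"
      then show False
        using t eq J[rule_format, of "l + n - Suc t" "l' + n - Suc t'"] J[rule_format, of "l' + n - Suc t'" "l + n - Suc t"]
        unfolding foguel_jumps_def mem_Collect_eq by linarith
    qed
    then show "x = y" using t eq xy by (auto simp: foguel_jumps_def)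
  qed
  have "(\<Sum>l<N. (cmod (\<Sum>t\<in>foguel_jumps J n l. z (2 * (l + n - Suc (2 * t)))))\<^sup>2)
      = (\<Sum>l<N. \<Sum>t\<in>foguel_jumps J n l. (cmod (z (2 * (l + n - Suc (2 * t)))))\<^sup>2)"
    by (intro sum.cong refl power2_sum_subsingleton one)
  also have "\<dots> = (\<Sum>p\<in>P. (cmod (z (i p)))\<^sup>2)"
    unfolding P_def i_def by (subst sum.Sigma) (auto simp: case_prod_unfold)
  also have "\<dots> = (\<Sum>k\<in>i ` P. (cmod (z k))\<^sup>2)"
    using inj by (simp add: sum.reindex)
  also have "\<dots> \<le> (l2norm z)\<^sup>2"
    by (rule sum_power2_cmod_le_suminf[OF z]) (simp add: P_def)
  finally show ?thesis .
qed

lemma foguel_power_bounded: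
  assumes J: "\<forall>j\<in>J. \<forall>j'\<in>J. j < j' \<longrightarrow> 2 * j < j'"
    and \<epsilon>: "0 \<le> \<epsilon>" and z: "z \<in> l2"
  shows "(foguel \<epsilon> J ^^ n) z \<in> l2" "l2norm ((foguel \<epsilon> J ^^ n) z) \<le> (1 + \<epsilon>) * l2norm z"
proof -
  let ?v = "\<lambda>l. \<Sum>t\<in>foguel_jumps J n l. z (2 * (l + n - Suc (2 * t)))"
  let ?g = "\<lambda>k. (cmod (z k))\<^sup>2"
  have "(\<Sum>k<N. (cmod ((foguel \<epsilon> J ^^ n) z k))\<^sup>2) \<le> ((1 + \<epsilon>) * l2norm z)\<^sup>2" for N
  proof -
    have even: "(\<Sum>m<N. (cmod ((foguel \<epsilon> J ^^ n) z (2 * m)))\<^sup>2) \<le> (\<Sum>m<N+n. ?g (2 * m))"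
    proof -
      have "(\<Sum>m<N. (cmod ((foguel \<epsilon> J ^^ n) z (2 * m)))\<^sup>2)
        = (\<Sum>m\<in>{n..<N}. ?g (2 * (m - n)))"
        by (rule sum.mono_neutral_cong_right) (auto simp: foguel_funpow_even)
      also have "\<dots> = (\<Sum>m\<in>(\<lambda>m. m - n) ` {n..<N}. ?g (2 * m))"
        by (subst sum.reindex) (auto simp: inj_on_def)
      also have "\<dots> \<le> (\<Sum>m<N+n. ?g (2 * m))"
        by (rule sum_mono2) auto
      finally show ?thesis .
    qed
    have shift: "(\<Sum>l<N. ?g (Suc (2 * (l + n)))) \<le> (\<Sum>l<N+n. ?g (Suc (2 * l)))"
    proof -
      have "(\<Sum>l<N. ?g (Suc (2 * (l + n)))) = (\<Sum>l\<in>(\<lambda>l. l + n) ` {..<N}. ?g (Suc (2 * l)))"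
        by (subst sum.reindex) auto
      also have "\<dots> \<le> (\<Sum>l<N+n. ?g (Suc (2 * l)))"
        by (rule sum_mono2) auto
      finally show ?thesis .
    qed
    have odd: "(\<Sum>l<N. (cmod ((foguel \<epsilon> J ^^ n) z (Suc (2 * l))))\<^sup>2)
      \<le> (1 + \<epsilon>) * ((\<Sum>l<N. ?g (Suc (2 * (l + n)))) + \<epsilon> * (\<Sum>l<N. (cmod (?v l))\<^sup>2))"
      unfolding foguel_funpow_odd sum_distrib_left[of \<epsilon>] sum_distrib_left[of "1 + \<epsilon>"] sum.distrib[symmetric]
      by (intro sum_mono cmod_add_scaled_power2_le \<epsilon>)
    have tot: "(\<Sum>m<N+n. ?g (2 * m)) + (\<Sum>l<N+n. ?g (Suc (2 * l))) \<le> (l2norm z)\<^sup>2"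
      using sum_power2_cmod_le_suminf[OF z, of "{..<2 * (N + n)}"] unfolding sum_even_odd by simp
    have e0: "0 \<le> (\<Sum>m<N+n. ?g (2 * m))" by (simp add: sum_nonneg)
    \<comment> \<open>Doubling the range lets the sum split evenly into even and odd
      coordinates.\<close>
    have "(\<Sum>k<N. (cmod ((foguel \<epsilon> J ^^ n) z k))\<^sup>2) \<le> (\<Sum>k<2*N. (cmod ((foguel \<epsilon> J ^^ n) z k))\<^sup>2)"
      by (rule sum_mono2) auto
    also have "\<dots> \<le> (\<Sum>m<N+n. ?g (2 * m))
        + (1 + \<epsilon>) * ((\<Sum>l<N+n. ?g (Suc (2 * l))) + \<epsilon> * (l2norm z)\<^sup>2)"
    proof -
      have "(1 + \<epsilon>) * ((\<Sum>l<N. ?g (Suc (2 * (l + n)))) + \<epsilon> * (\<Sum>l<N. (cmod (?v l))\<^sup>2))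
        \<le> (1 + \<epsilon>) * ((\<Sum>l<N+n. ?g (Suc (2 * l))) + \<epsilon> * (l2norm z)\<^sup>2)"
        using \<epsilon> shift foguel_jump_norm_le[OF J z, of n N]
        by (intro mult_left_mono add_mono) auto
      then show ?thesis unfolding sum_even_odd using even odd by linarith
    qed
    also have "\<dots> \<le> (1 + \<epsilon>) * ((\<Sum>m<N+n. ?g (2 * m)) + (\<Sum>l<N+n. ?g (Suc (2 * l)))) + (1 + \<epsilon>) * (\<epsilon> * (l2norm z)\<^sup>2)"
      using mult_nonneg_nonneg[OF \<epsilon> e0] by (simp add: algebra_simps)
    also have "\<dots> \<le> (1 + \<epsilon>) * (l2norm z)\<^sup>2 + (1 + \<epsilon>) * (\<epsilon> * (l2norm z)\<^sup>2)"
      using \<epsilon> tot by (intro add_mono mult_left_mono) auto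
    also have "\<dots> = ((1 + \<epsilon>) * l2norm z)\<^sup>2"
      by (simp add: power2_eq_square algebra_simps)
    finally show ?thesis .
  qed
  from l2_boundedI[OF this] \<epsilon> l2norm_nonneg[OF z]
  show "(foguel \<epsilon> J ^^ n) z \<in> l2" "l2norm ((foguel \<epsilon> J ^^ n) z) \<le> (1 + \<epsilon>) * l2norm z"
    by simp_all
qed

lemma l2_bounded_op_foguel:
  assumes J: "\<forall>j\<in>J. \<forall>j'\<in>J. j < j' \<longrightarrow> 2 * j < j'" and \<epsilon>: "0 \<le> \<epsilon>"
  shows "l2_bounded_op (foguel \<epsilon> J)"
proof -
  have "\<forall>z\<in>l2. foguel \<epsilon> J z \<in> l2" "\<exists>C. \<forall>z\<in>l2. l2norm (foguel \<epsilon> J z) \<le> C * l2norm z"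
    using foguel_power_bounded[OF J \<epsilon>, of _ 1] by auto
  then show ?thesis
    unfolding l2_bounded_op_def by (simp add: foguel_def fun_eq_iff algebra_simps)
qed

text \<open>A path from forward position 0 to backward position 0 takes \<open>t\<close> steps up,
  one coupling and \<open>t\<close> steps down. This matrix entry therefore reads off polynomial
  coefficients at the exponents \<open>2 * j + 1\<close> with \<open>j\<close> in
  \<open>J\<close>.\<close>

lemma foguel_funpow_unit_vector:
  "(foguel \<epsilon> J ^^ n) (\<lambda>i. if i = 0 then 1 else 0) (Suc 0)
     = (if n \<in> (\<lambda>j. Suc (2 * j)) ` J then complex_of_real \<epsilon> else 0)"
proof -
  have "(\<Sum>t\<in>foguel_jumps J n 0. if n \<le> Suc (2 * t) then 1 else 0)
      = (\<Sum>t\<in>foguel_jumps J n 0 \<inter> {t. n \<le> Suc (2 * t)}. 1::complex)"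
    by (simp add: sum.If_cases)
  also have "foguel_jumps J n 0 \<inter> {t. n \<le> Suc (2 * t)} = {t \<in> J. n = Suc (2 * t)}"
    by (auto simp: foguel_jumps_def)
  also have "\<dots> = (if n \<in> (\<lambda>j. Suc (2 * j)) ` J then {(n - 1) div 2} else {})"
    by auto
  finally show ?thesis using foguel_funpow_odd[of n \<epsilon> J _ 0] by simp
qed

section \<open>Rudin--Shapiro polynomials of weighted shifts\<close>

lemma l2_poly_op_0: "l2_poly_op 0 A z n = 0"
  by (simp add: l2_poly_op_def)

lemma l2_poly_op_add: "l2_poly_op (p + q) A z n = l2_poly_op p A z n + l2_poly_op q A z n"
  using l2_poly_op_eq[of "p + q" "max (degree p) (degree q)" A z n]
    l2_poly_op_eq[of p "max (degree p) (degree q)" A z n]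
    l2_poly_op_eq[of q "max (degree p) (degree q)" A z n]
  by (simp add: degree_add_le_max distrib_right sum.distrib)

lemma l2_poly_op_smult: "l2_poly_op (smult c p) A z n = c * l2_poly_op p A z n"
  using l2_poly_op_eq[of "smult c p" "degree p" A z n]
  by (simp add: l2_poly_op_def sum_distrib_left mult.assoc)

lemma l2_poly_op_diff: "l2_poly_op (p - q) A z n = l2_poly_op p A z n - l2_poly_op q A z n"
  using l2_poly_op_add[of "p - q" q A z n] by simp

lemma l2_poly_op_pCons_0_wshift:
  "l2_poly_op (pCons 0 p) (wshift w) z = wshift w (l2_poly_op p (wshift w) z)"
proof
  fix n
  have "l2_poly_op (pCons 0 p) (wshift w) z n
      = (\<Sum>i\<le>Suc (degree p). coeff (pCons 0 p) i * (wshift w ^^ i) z n)"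
    by (rule l2_poly_op_eq) (rule degree_pCons_le)
  also have "\<dots> = (\<Sum>i\<le>degree p. coeff p i * wshift w ((wshift w ^^ i) z) n)"
    by (subst sum.atMost_Suc_shift) simp
  also have "\<dots> = wshift w (l2_poly_op p (wshift w) z) n"
    by (simp add: wshift_def l2_poly_op_def sum_distrib_left algebra_simps)
  finally show "l2_poly_op (pCons 0 p) (wshift w) z n = wshift w (l2_poly_op p (wshift w) z) n" .
qed

lemma l2_poly_op_monom_mult_wshift:
  "l2_poly_op (monom 1 m * p) (wshift w) z = (wshift w ^^ m) (l2_poly_op p (wshift w) z)"
proof (induction m)
  case 0
  then show ?case by (simp add: monom_0)
next
  case (Suc m)
  then show ?case by (simp add: monom_Suc l2_poly_op_pCons_0_wshift)
qed

text \<open>The map on pairs is \<open>sqrt (1 + a\<^sup>2)\<close> times a rotation, so the cross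
  terms cancel.\<close>

lemma l2norm_parallelogram:
  assumes u: "u \<in> l2" and v: "v \<in> l2"
  shows "(l2norm (\<lambda>n. u n + complex_of_real a * v n))\<^sup>2 + (l2norm (\<lambda>n. v n - complex_of_real a * u n))\<^sup>2
    = (1 + a\<^sup>2) * ((l2norm u)\<^sup>2 + (l2norm v)\<^sup>2)"
proof -
  have sq: "(l2norm x)\<^sup>2 = (\<Sum>n. (cmod (x n))\<^sup>2)" "summable (\<lambda>n. (cmod (x n))\<^sup>2)"
    if "x \<in> l2" for x
    using that by (auto simp: l2norm_def l2_def suminf_nonneg)
  have x: "(\<lambda>n. u n + complex_of_real a * v n) \<in> l2"
    using l2_add(1)[OF u l2_scale(1)[OF v]] .
  have y: "(\<lambda>n. v n - complex_of_real a * u n) \<in> l2"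
    using l2_add(1)[OF v l2_scale(1)[OF u, of "- complex_of_real a"]] by simp
  have "(cmod (s + complex_of_real a * t))\<^sup>2 + (cmod (t - complex_of_real a * s))\<^sup>2
      = (1 + a\<^sup>2) * ((cmod s)\<^sup>2 + (cmod t)\<^sup>2)" for s t
    unfolding cmod_power2 by (simp add: power2_eq_square algebra_simps)
  then show ?thesis
    unfolding sq(1)[OF x] sq(1)[OF y] sq(1)[OF u] sq(1)[OF v]
      suminf_add[OF sq(2)[OF x] sq(2)[OF y]] suminf_add[OF sq(2)[OF u] sq(2)[OF v]]
    using suminf_mult[OF summable_add[OF sq(2)[OF u] sq(2)[OF v]], of "1 + a\<^sup>2"]
    by simp
qed

text \<open>The sequence \<open>m\<close> prescribes the exponents at which the first polynomial
  receives the coefficient \<open>a\<close>: the monomial factor moves the leading term of the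
  second one from exponent \<open>m k\<close> to \<open>m (Suc k)\<close>.\<close>

primrec shapiro_pair :: "real \<Rightarrow> (nat \<Rightarrow> nat) \<Rightarrow> nat \<Rightarrow> complex poly \<times> complex poly" where
  "shapiro_pair a m 0 = (0, monom 1 (m 0))"
| "shapiro_pair a m (Suc k) =
     (let f = fst (shapiro_pair a m k);
          g = monom 1 (m (Suc k) - m k) * snd (shapiro_pair a m k)
      in (f + smult (complex_of_real a) g, g - smult (complex_of_real a) f))"

text \<open>Multiplying by the monomial applies a contraction, and the recombination is a scaled
  rotation, so each step costs at most \<open>1 + a\<^sup>2\<close>.\<close>

lemma shapiro_pair_contraction_bound:
  assumes v: "\<And>s. cmod (v s) \<le> 1" and z: "z \<in> l2"
  shows "(l2norm (l2_poly_op (fst (shapiro_pair a m k)) (wshift v) z))\<^sup>2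
       + (l2norm (l2_poly_op (snd (shapiro_pair a m k)) (wshift v) z))\<^sup>2
       \<le> (1 + a\<^sup>2) ^ k * (l2norm z)\<^sup>2"
proof (induction k)
  note op = l2_bounded_op_wshift[of v 1, OF v]
  have pow: "(l2norm ((wshift v ^^ j) x))\<^sup>2 \<le> (l2norm x)\<^sup>2" if "x \<in> l2" for x j
  proof -
    have "l2norm ((wshift v ^^ j) x) \<le> l2norm x"
    proof (induction j)
      case (Suc j)
      have "l2norm (wshift v ((wshift v ^^ j) x)) \<le> l2norm ((wshift v ^^ j) x)"
        using l2norm_wshift_le(2)[of v 1, OF v l2_bounded_op_mem[OF l2_bounded_op_funpow[OF op] that]]
        by simp
      then show ?case using Suc.IH by simp
    qed simp
    then show ?thesis
      by (rule power_mono) (rule l2norm_nonneg[OF l2_bounded_op_mem[OF l2_bounded_op_funpow[OF op] that]])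
  qed
  {
    case 0
    have "l2_poly_op (monom 1 (m 0)) (wshift v) z = (wshift v ^^ m 0) z"
      using l2_poly_op_monom_mult_wshift[of "m 0" 1 v z] by (simp add: l2_poly_op_def)
    moreover have "l2_poly_op 0 (wshift v) z = (\<lambda>n. 0)" by (simp add: fun_eq_iff l2_poly_op_0)
    ultimately show ?case using pow[OF z] by (simp add: l2_zero)
  next
    case (Suc k)
    define f where "f = l2_poly_op (fst (shapiro_pair a m k)) (wshift v) z"
    define g where "g = l2_poly_op (snd (shapiro_pair a m k)) (wshift v) z"
    define h where "h = (wshift v ^^ (m (Suc k) - m k)) g"
    have f: "f \<in> l2" and g: "g \<in> l2"
      unfolding f_def g_def by (intro l2_bounded_op_mem[OF l2_bounded_op_poly[OF op] z])+
    have h: "h \<in> l2" unfolding h_def by (intro l2_bounded_op_mem[OF l2_bounded_op_funpow[OF op] g])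
    have "l2_poly_op (fst (shapiro_pair a m (Suc k))) (wshift v) z = (\<lambda>n. f n + complex_of_real a * h n)"
      and "l2_poly_op (snd (shapiro_pair a m (Suc k))) (wshift v) z = (\<lambda>n. h n - complex_of_real a * f n)"
      by (simp_all add: fun_eq_iff Let_def l2_poly_op_add l2_poly_op_diff l2_poly_op_smult
          l2_poly_op_monom_mult_wshift f_def g_def h_def)
    then have "(l2norm (l2_poly_op (fst (shapiro_pair a m (Suc k))) (wshift v) z))\<^sup>2
       + (l2norm (l2_poly_op (snd (shapiro_pair a m (Suc k))) (wshift v) z))\<^sup>2
       = (1 + a\<^sup>2) * ((l2norm f)\<^sup>2 + (l2norm h)\<^sup>2)"
      using l2norm_parallelogram[OF f h] by simp
    also have "\<dots> \<le> (1 + a\<^sup>2) * ((l2norm f)\<^sup>2 + (l2norm g)\<^sup>2)"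
      using pow[OF g] by (intro mult_left_mono) (simp_all add: h_def)
    also have "\<dots> \<le> (1 + a\<^sup>2) * ((1 + a\<^sup>2) ^ k * (l2norm z)\<^sup>2)"
      using Suc.IH by (intro mult_left_mono) (simp_all add: f_def g_def)
    finally show ?case by (simp add: mult.assoc)
  }
qed

text \<open>The doubling condition shifts the second polynomial entirely above degree
  \<open>m k\<close>, so later steps leave the coefficients of the first polynomial that are already
  present unchanged.\<close>

lemma shapiro_pair_coeff:
  assumes m: "\<And>k. 2 * m k < m (Suc k)"
  shows "degree (fst (shapiro_pair a m k)) \<le> m k" "degree (snd (shapiro_pair a m k)) \<le> m k"
    "coeff (snd (shapiro_pair a m k)) (m k) = 1"
    "coeff (fst (shapiro_pair a m k)) (m j) = (if 1 \<le> j \<and> j \<le> k then complex_of_real a else 0)"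
proof -
  have mono: "strict_mono m"
    unfolding strict_mono_Suc_iff using m by (metis add_lessD1 mult_2)
  have "degree (fst (shapiro_pair a m k)) \<le> m k \<and> degree (snd (shapiro_pair a m k)) \<le> m k
    \<and> coeff (snd (shapiro_pair a m k)) (m k) = 1
    \<and> (\<forall>j. coeff (fst (shapiro_pair a m k)) (m j) = (if 1 \<le> j \<and> j \<le> k then complex_of_real a else 0))"
  proof (induction k)
    case 0
    then show ?case by (simp add: degree_monom_le)
  next
    case (Suc k)
    define f where "f = fst (shapiro_pair a m k)"
    define g where "g = snd (shapiro_pair a m k)"
    define h where "h = monom 1 (m (Suc k) - m k) * g"
    have IH: "degree f \<le> m k" "degree g \<le> m k" "coeff g (m k) = 1"
      "\<And>j. coeff f (m j) = (if 1 \<le> j \<and> j \<le> k then complex_of_real a else 0)"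
      using Suc.IH by (auto simp: f_def g_def)
    have mk: "m k < m (Suc k) - m k" "m k < m (Suc k)" using m[of k] by linarith+
    have dh: "degree h \<le> m (Suc k)"
      unfolding h_def using degree_mult_le[of "monom 1 (m (Suc k) - m k)" g]
        degree_monom_le[of "1::complex" "m (Suc k) - m k"] IH(2) mk by linarith
    have h0: "coeff h i = 0" if "i \<le> m k" for i
      using that mk by (simp add: h_def coeff_monom_mult)
    have h1: "coeff h (m (Suc k)) = 1"
      using mk IH(3) by (simp add: h_def coeff_monom_mult)
    have f1: "coeff f (m (Suc k)) = 0" using IH(4)[of "Suc k"] by simp
    have df: "degree f \<le> m (Suc k)" using IH(1) mk by simp
    have F: "fst (shapiro_pair a m (Suc k)) = f + smult (complex_of_real a) h"
      "snd (shapiro_pair a m (Suc k)) = h - smult (complex_of_real a) f"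
      by (simp_all add: f_def g_def h_def Let_def)
    have "coeff (f + smult (complex_of_real a) h) (m j)
       = (if 1 \<le> j \<and> j \<le> Suc k then complex_of_real a else 0)" for j
    proof -
      consider "j \<le> k" | "j = Suc k" | "j > Suc k" by linarith
      then show ?thesis
      proof cases
        case 1
        then have "m j \<le> m k" using mono by (simp add: strict_mono_less_eq)
        then show ?thesis using 1 IH(4)[of j] h0 by simp
      next
        case 2
        then show ?thesis using f1 h1 by simp
      next
        case 3
        then have "m (Suc k) < m j" using mono by (simp add: strict_mono_less)
        then show ?thesis using 3 dh IH(4)[of j] by (simp add: coeff_eq_0)
      qed
    qed
    moreover have "degree (f + smult (complex_of_real a) h) \<le> m (Suc k)"
      using df dh degree_smult_le[of "complex_of_real a" h] by (intro degree_add_le) auto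
    moreover have "degree (h - smult (complex_of_real a) f) \<le> m (Suc k)"
      using df dh degree_smult_le[of "complex_of_real a" f] by (intro degree_diff_le) auto
    ultimately show ?case unfolding F using h1 f1 by simp
  qed
  then show "degree (fst (shapiro_pair a m k)) \<le> m k" "degree (snd (shapiro_pair a m k)) \<le> m k"
    "coeff (snd (shapiro_pair a m k)) (m k) = 1"
    "coeff (fst (shapiro_pair a m k)) (m j) = (if 1 \<le> j \<and> j \<le> k then complex_of_real a else 0)"
    by blast+
qed

section \<open>Transfer from contractive to power bounded shifts\<close>

text \<open>Diagonal renorming: \<open>d i\<close> is the supremum of the norms of all powers of the
  shift at the \<open>i\<close>-th unit vector. The empty product gives \<open>1 \<le> d i\<close>,
  and one application of the shift cannot increase this supremum.\<close>

lemma wshift_similar_to_contraction: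
  assumes M: "\<And>i n. (\<Prod>k=i+1..i+n. cmod (w k)) \<le> M"
  obtains d :: "nat \<Rightarrow> real" and v where "\<And>n. 1 \<le> d n" "\<And>n. d n \<le> M" "\<And>n. cmod (v n) \<le> 1"
    "\<And>z n. complex_of_real (d n) * wshift w z n = wshift v (\<lambda>i. complex_of_real (d i) * z i) n"
proof -
  define P where "P i n = (\<Prod>k=i+1..i+n. cmod (w k))" for i n
  define d where "d i = (SUP n. P i n)" for i
  have bdd: "bdd_above (range (P i))" for i
    using M by (auto simp: P_def intro!: bdd_aboveI2[of _ _ M])
  have up: "P i n \<le> d i" for i n
    unfolding d_def by (rule cSUP_upper[OF _ bdd]) simp
  have d1: "1 \<le> d i" for i using up[of i 0] by (simp add: P_def)
  have dM: "d i \<le> M" for i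
    unfolding d_def by (rule cSUP_least) (use M in \<open>auto simp: P_def\<close>)
  have step: "cmod (w (Suc i)) * d (Suc i) \<le> d i" for i
  proof (cases "w (Suc i) = 0")
    case True
    then show ?thesis using d1[of i] by simp
  next
    case False
    have "d (Suc i) \<le> d i / cmod (w (Suc i))"
      unfolding d_def[of "Suc i"]
    proof (rule cSUP_least)
      fix n
      have "cmod (w (Suc i)) * P (Suc i) n = P i (Suc n)"
        unfolding P_def by (subst prod.atLeast_Suc_atMost[of "i + 1"]) auto
      then show "P (Suc i) n \<le> d i / cmod (w (Suc i))"
        using up[of i "Suc n"] False by (simp add: field_simps)
    qed simp
    then show ?thesis using False by (simp add: field_simps)
  qed
  define v where "v n = (if n = 0 then 0 else complex_of_real (d n) * w n / complex_of_real (d (n - 1)))" for n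
  have "cmod (v n) \<le> 1" for n
    using step[of "n - 1"] d1[of "n - 1"] d1[of n]
    by (cases n) (auto simp: v_def norm_mult norm_divide field_simps)
  moreover have "complex_of_real (d n) * wshift w z n = wshift v (\<lambda>i. complex_of_real (d i) * z i) n" for z n
    using d1[of "n - 1"] by (simp add: v_def wshift_def)
  ultimately show thesis using that d1 dM by blast
qed

text \<open>The diagonal operator \<open>D\<close> intertwines the two shifts. Its norm is at most
  \<open>M\<close>, and its entries are at least 1, so undoing it costs nothing.\<close>

lemma shapiro_pair_shift_bound:
  assumes M: "\<And>i n. (\<Prod>k=i+1..i+n. cmod (w k)) \<le> M" and z: "z \<in> l2" "l2norm z \<le> 1"
    and f: "f = fst (shapiro_pair a m k)"
  shows "(l2norm (l2_poly_op f (wshift w) z))\<^sup>2 \<le> (1 + a\<^sup>2) ^ k * M\<^sup>2"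
proof -
  obtain d v where d: "\<And>n. 1 \<le> d n" "\<And>n. d n \<le> M" and v: "\<And>n. cmod (v n) \<le> 1"
    and dv: "\<And>z n. complex_of_real (d n) * wshift w z n = wshift v (\<lambda>i. complex_of_real (d i) * z i) n"
    using wshift_similar_to_contraction[of w M, OF M] by blast
  define D where "D = (\<lambda>z n. complex_of_real (d n) * z n)"
  have D: "D (wshift w z) = wshift v (D z)" for z
    unfolding D_def using dv by (simp add: fun_eq_iff)
  have "D ((wshift w ^^ i) z) = (wshift v ^^ i) (D z)" for i
    by (induction i) (simp_all add: D)
  then have Df: "D (l2_poly_op f (wshift w) z) = l2_poly_op f (wshift v) (D z)"
    by (simp add: fun_eq_iff l2_poly_op_def D_def sum_distrib_left mult.left_commute)
  have M0: "0 \<le> M" using d[of 0] by simp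
  have Dz: "D z \<in> l2" "l2norm (D z) \<le> M"
  proof -
    have "(\<Sum>i<n. (cmod (D z i))\<^sup>2) \<le> M\<^sup>2" for n
    proof -
      have "(\<Sum>i<n. (cmod (D z i))\<^sup>2) \<le> (\<Sum>i<n. M\<^sup>2 * (cmod (z i))\<^sup>2)"
        unfolding D_def norm_mult power_mult_distrib
        using d order_trans[OF zero_le_one d(1)]
        by (intro sum_mono mult_right_mono power_mono) auto
      also have "\<dots> \<le> M\<^sup>2 * (l2norm z)\<^sup>2"
        unfolding sum_distrib_left[symmetric]
        by (intro mult_left_mono sum_power2_cmod_le_suminf z) auto
      also have "\<dots> \<le> M\<^sup>2 * 1"
        using z l2norm_nonneg[OF z(1)] by (intro mult_left_mono) (auto simp: power_le_one)
      finally show ?thesis by simp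
    qed
    from l2_boundedI[OF this M0] show "D z \<in> l2" "l2norm (D z) \<le> M" by auto
  qed
  have fD: "l2_poly_op f (wshift v) (D z) \<in> l2"
    by (rule l2_bounded_op_mem[OF l2_bounded_op_poly[OF l2_bounded_op_wshift[of v 1, OF v]] Dz(1)])
  have "(\<Sum>i<n. (cmod (l2_poly_op f (wshift w) z i))\<^sup>2) \<le> (l2norm (l2_poly_op f (wshift v) (D z)))\<^sup>2" for n
  proof -
    have "cmod (l2_poly_op f (wshift w) z i) \<le> cmod (l2_poly_op f (wshift v) (D z) i)" for i
      unfolding Df[symmetric] unfolding D_def norm_mult
      using mult_right_mono[OF d(1)[of i] norm_ge_zero[of "l2_poly_op f (wshift w) z i"]] d(1)[of i]
      by simp
    then have "(\<Sum>i<n. (cmod (l2_poly_op f (wshift w) z i))\<^sup>2)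
      \<le> (\<Sum>i<n. (cmod (l2_poly_op f (wshift v) (D z) i))\<^sup>2)"
      by (intro sum_mono power_mono) auto
    also have "\<dots> \<le> (l2norm (l2_poly_op f (wshift v) (D z)))\<^sup>2"
      by (rule sum_power2_cmod_le_suminf[OF fD]) simp
    finally show ?thesis .
  qed
  note b = l2_boundedI[OF this l2norm_nonneg[OF fD]]
  have "(l2norm (l2_poly_op f (wshift w) z))\<^sup>2 \<le> (l2norm (l2_poly_op f (wshift v) (D z)))\<^sup>2"
    using b l2norm_nonneg[OF b(1)] by (intro power_mono)
  also have "\<dots> \<le> (1 + a\<^sup>2) ^ k * (l2norm (D z))\<^sup>2"
    using shapiro_pair_contraction_bound[of v, OF v Dz(1), of a m k] unfolding f
    by (smt (verit) zero_le_power2)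
  also have "\<dots> \<le> (1 + a\<^sup>2) ^ k * M\<^sup>2"
    using Dz l2norm_nonneg[OF Dz(1)] by (intro mult_left_mono power_mono) auto
  finally show ?thesis .
qed

lemma doubling_range_gap:
  fixes j :: "nat \<Rightarrow> nat"
  assumes j: "\<And>k. 2 * j k < j (Suc k)"
  shows "\<forall>x\<in>range j. \<forall>y\<in>range j. x < y \<longrightarrow> 2 * x < y"
proof (intro ballI impI)
  have mono: "strict_mono j"
    unfolding strict_mono_Suc_iff using j by (metis add_lessD1 mult_2)
  fix x y assume "x \<in> range j" "y \<in> range j" "x < y"
  then obtain k l where kl: "x = j k" "y = j l" by blast
  then have "k < l" using \<open>x < y\<close> mono by (simp add: strict_mono_less)
  then have "j (Suc k) \<le> j l" using mono by (simp add: strict_mono_less_eq)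
  then show "2 * x < y" using j[of k] kl by simp
qed

section \<open>Nonexistence of a dominating power bounded shift\<close>

text \<open>The exponents \<open>m k\<close> are exactly the times \<open>2 * j k + 1\<close> at
  which the Foguel entry equals \<open>\<epsilon>\<close>; that entry of \<open>f(A)\<close> sums
  the \<open>N\<close> coefficients \<open>a\<close> of \<open>f\<close> without
  cancellation.\<close>

lemma foguel_shapiro_lower_bound:
  fixes j :: "nat \<Rightarrow> nat"
  assumes j: "\<And>k. 2 * j k < j (Suc k)" and \<epsilon>: "0 \<le> \<epsilon>" and a: "0 \<le> a"
    and m: "m = (\<lambda>k. Suc (2 * j k))"
  shows "\<epsilon> * a * real N \<le> l2_opnorm (l2_poly_op (fst (shapiro_pair a m N)) (foguel \<epsilon> (range j)))"
proof -
  have mono: "strict_mono j"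
    unfolding strict_mono_Suc_iff using j by (metis add_lessD1 mult_2)
  have m2: "2 * m k < m (Suc k)" for k
    using j[of k] by (simp add: m)
  have sm: "strict_mono m"
    using mono by (auto simp: m strict_mono_def)
  note gap = doubling_range_gap[of j, OF j]
  define f where "f = fst (shapiro_pair a m N)"
  define A where "A = foguel \<epsilon> (range j)"
  define e :: "nat \<Rightarrow> complex" where "e = (\<lambda>i. if i = 0 then 1 else 0)"
  have A: "l2_bounded_op A" unfolding A_def by (rule l2_bounded_op_foguel[OF gap \<epsilon>])
  have e: "e \<in> l2" "l2norm e = 1" using l2_unit_vector[of 0] by (auto simp: e_def)
  have im: "{..m N} \<inter> range m = m ` {..N}"
    using sm by (auto simp: strict_mono_less_eq)
  have "l2_poly_op f A e (Suc 0) = (\<Sum>i\<le>m N. coeff f i * (if i \<in> range m then complex_of_real \<epsilon> else 0))"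
    unfolding l2_poly_op_eq[OF shapiro_pair_coeff(1)[of m a N, OF m2, folded f_def]]
    unfolding A_def e_def foguel_funpow_unit_vector by (simp add: m image_image)
  also have "\<dots> = (\<Sum>i\<in>m ` {..N}. coeff f i * complex_of_real \<epsilon>)"
    unfolding im[symmetric] by (subst sum.inter_restrict) (auto intro: sum.cong)
  also have "\<dots> = (\<Sum>k\<le>N. coeff f (m k) * complex_of_real \<epsilon>)"
    using sm by (subst sum.reindex) (auto simp: strict_mono_imp_inj_on)
  also have "\<dots> = (\<Sum>k\<in>{1..N}. complex_of_real (\<epsilon> * a))"
    unfolding f_def shapiro_pair_coeff(4)[of m, OF m2]
    by (rule sum.mono_neutral_cong_right) auto
  finally have "\<epsilon> * a * real N = cmod (l2_poly_op f A e (Suc 0))"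
    using \<epsilon> a by (simp add: norm_mult)
  also have "cmod (l2_poly_op f A e (Suc 0)) \<le> l2norm (l2_poly_op f A e)"
    by (rule cmod_le_l2norm[OF l2_bounded_op_mem[OF l2_bounded_op_poly[OF A] e(1)]])
  also have "\<dots> \<le> l2_opnorm (l2_poly_op f A)"
    using l2norm_le_opnorm[OF l2_bounded_op_poly[OF A] e(1), of f] e(2) by simp
  finally show ?thesis by (simp add: f_def A_def)
qed

text \<open>The product of weights is the modulus of a matrix entry of the \<open>n\<close>-th
  power.\<close>

lemma wshift_power_bounded_weights:
  assumes w: "\<And>s. cmod (w s) \<le> C" and M: "\<And>n. l2_opnorm (wshift w ^^ n) \<le> M"
  shows "(\<Prod>k=i+1..i+n. cmod (w k)) \<le> M"
proof -
  define e :: "nat \<Rightarrow> complex" where "e = (\<lambda>k. if k = i then 1 else 0)"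
  have e: "e \<in> l2" "l2norm e = 1" using l2_unit_vector[of i] by (auto simp: e_def)
  note op = l2_bounded_op_funpow[OF l2_bounded_op_wshift[of w C, OF w], of n]
  have "(\<Prod>k=i+1..i+n. cmod (w k)) = cmod ((wshift w ^^ n) e (i + n))"
    by (simp add: wshift_funpow e_def prod_norm)
  also have "\<dots> \<le> l2norm ((wshift w ^^ n) e)"
    by (rule cmod_le_l2norm[OF l2_bounded_op_mem[OF op e(1)]])
  also have "\<dots> \<le> M"
    using l2norm_le_opnorm[OF op e(1)] e(2) M[of n] by simp
  finally show ?thesis .
qed

text \<open>On \<open>E\<close> the polynomials stay below \<open>sqrt (exp 1) * M\<close> whatever
  \<open>N\<close> is, while on Foguel's operator they reach
  \<open>\<epsilon> * sqrt N\<close>.\<close>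

lemma no_dominating_weighted_shift:
  assumes K: "1 < K" and E: "weighted_forward_shift E" "l2_power_bounded E"
  shows "\<exists>A f. l2_bounded_op A \<and> (\<forall>n. l2_opnorm (A ^^ n) \<le> K)
    \<and> l2_opnorm (l2_poly_op f E) < l2_opnorm (l2_poly_op f A)"
proof -
  obtain w C where w: "\<And>s. cmod (w s) \<le> C" and Ew: "E = wshift w"
    using E(1) by (auto simp: weighted_forward_shift_def)
  obtain M where "\<And>n. l2_opnorm (wshift w ^^ n) \<le> M"
    using E(2) by (auto simp: l2_power_bounded_def Ew)
  note M = wshift_power_bounded_weights[of w C, OF w this]
  have M1: "1 \<le> M" using M[of 0 0] by simp
  \<comment> \<open>Makes the power bound \<open>1 + \<epsilon>\<close> equal to
    \<open>K\<close>.\<close>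
  define \<epsilon> where "\<epsilon> = K - 1"
  have \<epsilon>: "0 < \<epsilon>" using K by (simp add: \<epsilon>_def)
  define j :: "nat \<Rightarrow> nat" where "j k = 3 ^ k" for k
  have j: "2 * j k < j (Suc k)" for k by (simp add: j_def)
  note gap = doubling_range_gap[of j, OF j]
  define A where "A = foguel \<epsilon> (range j)"
  obtain N :: nat where N: "(sqrt (exp 1) * M / \<epsilon>)\<^sup>2 < real N"
    using reals_Archimedean2 by blast
  have N0: "0 < N" using N by (cases N) (auto simp: not_less)
  \<comment> \<open>The balance point: \<open>(1 + a\<^sup>2) ^ N\<close> stays below
    \<open>exp 1\<close>, yet \<open>a * N = sqrt N\<close> is unbounded.\<close>
  define a where "a = 1 / sqrt (real N)"
  have a2: "a\<^sup>2 = 1 / real N" by (simp add: a_def power_divide)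
  define f where "f = fst (shapiro_pair a (\<lambda>k. Suc (2 * j k)) N)"
  have "(1 + a\<^sup>2) ^ N \<le> exp (a\<^sup>2) ^ N"
    by (intro power_mono) auto
  also have "\<dots> = exp 1" using N0 by (simp add: exp_of_nat_mult[symmetric] a2)
  finally have eb: "(1 + a\<^sup>2) ^ N \<le> exp 1" .
  have "l2_opnorm (l2_poly_op f E) \<le> sqrt (exp 1) * M"
  proof (rule l2_opnorm_le)
    fix z assume z: "z \<in> l2" "l2norm z \<le> 1"
    have "(l2norm (l2_poly_op f E z))\<^sup>2 \<le> (1 + a\<^sup>2) ^ N * M\<^sup>2"
      unfolding Ew by (rule shapiro_pair_shift_bound[OF M z f_def])
    also have "\<dots> \<le> (sqrt (exp 1) * M)\<^sup>2"
      using eb by (simp add: power_mult_distrib mult_right_mono)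
    finally show "l2norm (l2_poly_op f E z) \<le> sqrt (exp 1) * M"
      by (rule power2_le_imp_le) (use M1 in simp)
  qed
  also have "\<dots> < \<epsilon> * sqrt (real N)"
    using real_less_rsqrt[OF N] \<epsilon> by (simp add: field_simps)
  also have "\<dots> = \<epsilon> * a * real N"
    by (subst real_div_sqrt[symmetric]) (simp_all add: a_def)
  also have "\<dots> \<le> l2_opnorm (l2_poly_op f A)"
    unfolding f_def A_def using foguel_shapiro_lower_bound[of j \<epsilon> a, OF j _ _ refl] \<epsilon>
    by (simp add: a_def)
  finally have "l2_opnorm (l2_poly_op f E) < l2_opnorm (l2_poly_op f A)" .
  moreover have "l2_bounded_op A"
    unfolding A_def using l2_bounded_op_foguel[OF gap] \<epsilon> by simp
  moreover have "l2_opnorm (A ^^ n) \<le> K" for n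
  proof (rule l2_opnorm_le)
    fix z assume z: "z \<in> l2" "l2norm z \<le> 1"
    have "l2norm ((A ^^ n) z) \<le> (1 + \<epsilon>) * l2norm z"
      unfolding A_def using foguel_power_bounded(2)[OF gap _ z(1)] \<epsilon> by simp
    also have "\<dots> \<le> (1 + \<epsilon>) * 1" using z \<epsilon> by (intro mult_left_mono) auto
    finally show "l2norm ((A ^^ n) z) \<le> K" by (simp add: \<epsilon>_def)
  qed
  ultimately show ?thesis by blast
qed

theorem theorem2p6:
  fixes K :: real
  assumes "K > 1"
  shows "(\<forall>(T::'a::chilbert_space \<Rightarrow> 'a) (p::complex poly).
            bounded_clinear T \<and> (\<forall>n. onorm (T ^^ n) \<le> K) \<longrightarrow>
            onorm (cpoly_op p T) \<le> l2_opnorm (l2_poly_op p (S_K K)))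
       \<and> \<not> (\<exists>E. weighted_forward_shift E \<and> l2_power_bounded E \<and>
              (\<forall>A f. l2_bounded_op A \<and> (\<forall>n. l2_opnorm (A ^^ n) \<le> K) \<longrightarrow>
                     l2_opnorm (l2_poly_op f A) \<le> l2_opnorm (l2_poly_op f E)))"
proof
  show "\<forall>(T::'a::chilbert_space \<Rightarrow> 'a) (p::complex poly).
      bounded_clinear T \<and> (\<forall>n. onorm (T ^^ n) \<le> K) \<longrightarrow>
      onorm (cpoly_op p T) \<le> l2_opnorm (l2_poly_op p (S_K K))"
  proof (intro allI impI)
    fix T :: "'a \<Rightarrow> 'a" and p
    assume T: "bounded_clinear T \<and> (\<forall>n. onorm (T ^^ n) \<le> K)"
    show "onorm (cpoly_op p T) \<le> l2_opnorm (l2_poly_op p (S_K K))"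
    proof (rule onorm_bound)
      show "0 \<le> l2_opnorm (l2_poly_op p (S_K K))"
        by (intro l2_opnorm_nonneg l2_bounded_op_poly l2_bounded_op_S_K assms)
      show "norm (cpoly_op p T h) \<le> l2_opnorm (l2_poly_op p (S_K K)) * norm h" for h
        using power_bounded_poly_le[OF assms] T by blast
    qed
  qed
next
  show "\<not> (\<exists>E. weighted_forward_shift E \<and> l2_power_bounded E \<and>
      (\<forall>A f. l2_bounded_op A \<and> (\<forall>n. l2_opnorm (A ^^ n) \<le> K) \<longrightarrow>
        l2_opnorm (l2_poly_op f A) \<le> l2_opnorm (l2_poly_op f E)))"
    using no_dominating_weighted_shift[OF assms] by (meson not_less)
qed

end
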